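(* Let $T$ be a complete theory and $X$ a $\emptyset$-type-definable set (given by a partial type $\pi(x)$ over $\emptyset$). For a model ${\mathfrak C}$ of $T$ which is $\aleph_0$-saturated and strongly $\aleph_0$-homogeneous, let $\mathcal{M}$ be a minimal left ideal of the Ellis semigroup $E(S_X({\mathfrak C}))$ of the flow $(\operatorname{Aut}({\mathfrak C}),S_X({\mathfrak C}))$, $u\in\mathcal{M}$ an idempotent, and $\overline{\mathcal{J}}_{\mathfrak C}:=\operatorname{Im}(u)$. Then, up to isomorphism of infinitary definability patterns structures, $\overline{\mathcal{J}}_{\mathfrak C}$ does not depend on the choice of ${\mathfrak C}$ (nor of $\mathcal{M},u$): for any two such models ${\mathfrak C}_1,{\mathfrak C}_2$, $\overline{\mathcal{J}}_{{\mathfrak C}_1}\cong\overline{\mathcal{J}}_{{\mathfrak C}_2}$.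
   Context: $S_X({\mathfrak C})$: complete types over ${\mathfrak C}$ containing $\pi$, with $\operatorname{Aut}({\mathfrak C})$ acting by $\sigma(p)=\{\varphi(x,\sigma(c)):\varphi(x,c)\in p\}$. The Ellis semigroup is the closure of $\{p\mapsto\sigma(p):\sigma\in\operatorname{Aut}({\mathfrak C})\}$ in $S_X({\mathfrak C})^{S_X({\mathfrak C})}$ with composition. Infinitary definability patterns structure on a subset of $S_X({\mathfrak C})$: for formulas $\varphi_1(x,y),\dots,\varphi_n(x,y)$ with $y$ finite and $q(y)\in S_y(\emptyset)$, the relation $R_{\bar\varphi,q}(p_1,\dots,p_n)$ holds iff there is no $b\models q$ with $\varphi_i(x,b)\in p_i$ for all $i\le n$; an isomorphism between subsets (possibly of type spaces over different models) is a bijection preserving and reflecting all $R_{\bar\varphi,q}$. *)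

theory Defs
  imports "HOL-Analysis.Analysis"
begin

section \<open>First-order logic\<close>

text \<open>A symbol belongs to the language iff its arity is defined.\<close>

record ('f, 'r) lang =
  farity :: "'f \<Rightarrow> nat option"
  rarity :: "'r \<Rightarrow> nat option"

text \<open>
  Locally nameless syntax: \<open>Var v\<close> is a free variable, \<open>Bnd n\<close> a de Bruijn index. A formula with
  parameters from a structure on \<open>'a\<close> is a formula over \<open>'v + 'a\<close>: \<open>Var (Inl v)\<close> is
  the variable \<open>v\<close>, and \<open>Var (Inr c)\<close> is always evaluated as \<open>c\<close>, so it is the constant naming \<open>c\<close>.
  Substitution of parameters for variables is then a renaming of free variables.
\<close>

datatype (dead 'f, fv_tm: 'v) tm = Var 'v | Bnd nat | Fun 'f "('f, 'v) tm list"
  for map: rename_tm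

datatype (dead 'f, dead 'r, fv: 'v) fm =
    Bot
  | Eq "('f, 'v) tm" "('f, 'v) tm"
  | Rel 'r "('f, 'v) tm list"
  | Imp "('f, 'r, 'v) fm" "('f, 'r, 'v) fm"
  | All "('f, 'r, 'v) fm"
  for map: rename

definition Neg :: "('f, 'r, 'v) fm \<Rightarrow> ('f, 'r, 'v) fm" where
  "Neg \<phi> = Imp \<phi> Bot"

text \<open>Arities are respected, and every de Bruijn index is bound once \<open>k\<close> binders are added.\<close>

fun wf_tm :: "('f, 'r) lang \<Rightarrow> nat \<Rightarrow> ('f, 'v) tm \<Rightarrow> bool" where
  "wf_tm L k (Var v) \<longleftrightarrow> True"
| "wf_tm L k (Bnd n) \<longleftrightarrow> n < k"
| "wf_tm L k (Fun f ts) \<longleftrightarrow> farity L f = Some (length ts) \<and> (\<forall>t\<in>set ts. wf_tm L k t)"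

fun wf_fm :: "('f, 'r) lang \<Rightarrow> nat \<Rightarrow> ('f, 'r, 'v) fm \<Rightarrow> bool" where
  "wf_fm L k Bot \<longleftrightarrow> True"
| "wf_fm L k (Eq s t) \<longleftrightarrow> wf_tm L k s \<and> wf_tm L k t"
| "wf_fm L k (Rel r ts) \<longleftrightarrow> rarity L r = Some (length ts) \<and> (\<forall>t\<in>set ts. wf_tm L k t)"
| "wf_fm L k (Imp \<phi> \<psi>) \<longleftrightarrow> wf_fm L k \<phi> \<and> wf_fm L k \<psi>"
| "wf_fm L k (All \<phi>) \<longleftrightarrow> wf_fm L (Suc k) \<phi>"

definition formulas :: "('f, 'r) lang \<Rightarrow> 'v set \<Rightarrow> ('f, 'r, 'v) fm set" where
  "formulas L V = {\<phi>. wf_fm L 0 \<phi> \<and> fv \<phi> \<subseteq> V}"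

text \<open>The universe of a structure is the whole type \<open>'a\<close>.\<close>

record ('f, 'r, 'a) struct =
  fint :: "'f \<Rightarrow> 'a list \<Rightarrow> 'a"
  rint :: "'r \<Rightarrow> 'a list \<Rightarrow> bool"

fun val :: "('f, 'r, 'a) struct \<Rightarrow> ('v \<Rightarrow> 'a) \<Rightarrow> 'a list \<Rightarrow> ('f, 'v) tm \<Rightarrow> 'a" where
  "val M e bs (Var v) = e v"
| "val M e bs (Bnd n) = bs ! n"
| "val M e bs (Fun f ts) = fint M f (map (val M e bs) ts)"

fun sat :: "('f, 'r, 'a) struct \<Rightarrow> ('v \<Rightarrow> 'a) \<Rightarrow> 'a list \<Rightarrow> ('f, 'r, 'v) fm \<Rightarrow> bool" where
  "sat M e bs Bot \<longleftrightarrow> False"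
| "sat M e bs (Eq s t) \<longleftrightarrow> val M e bs s = val M e bs t"
| "sat M e bs (Rel r ts) \<longleftrightarrow> rint M r (map (val M e bs) ts)"
| "sat M e bs (Imp \<phi> \<psi>) \<longleftrightarrow> (sat M e bs \<phi> \<longrightarrow> sat M e bs \<psi>)"
| "sat M e bs (All \<phi>) \<longleftrightarrow> (\<forall>a. sat M e (a # bs) \<phi>)"

text \<open>
  Theories are deductively closed. A consistent set of sentences is a complete theory iff it is
  maximal; consistency itself is expressed by the existence of a model.
\<close>

definition complete_theory :: "('f, 'r) lang \<Rightarrow> ('f, 'r, 'v) fm set \<Rightarrow> bool" where
  "complete_theory L T \<longleftrightarrow>
     T \<subseteq> formulas L {} \<and> (\<forall>\<phi>\<in>formulas L {}. (\<phi> \<in> T) \<noteq> (Neg \<phi> \<in> T))"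

definition models :: "('f, 'r, 'a) struct \<Rightarrow> ('f, 'r, 'v) fm set \<Rightarrow> bool" where
  "models M T \<longleftrightarrow> (\<forall>\<phi>\<in>T. \<forall>e. sat M e [] \<phi>)"

section \<open>Types, saturation, homogeneity\<close>

definition realizes ::
    "('f, 'r, 'a) struct \<Rightarrow> ('v \<Rightarrow> 'a) \<Rightarrow> ('f, 'r, 'v + 'a) fm set \<Rightarrow> bool" where
  "realizes M e p \<longleftrightarrow> (\<forall>\<phi>\<in>p. sat M (case_sum e id) [] \<phi>)"

text \<open>\<open>complete_types L M V A\<close>: complete types over \<open>A\<close> in the variables \<open>V\<close>.\<close>

definition complete_types ::
    "('f, 'r) lang \<Rightarrow> ('f, 'r, 'a) struct \<Rightarrow> 'v set \<Rightarrow> 'a set \<Rightarrow> ('f, 'r, 'v + 'a) fm set set" where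
  "complete_types L M V A =
     {p. p \<subseteq> formulas L (V <+> A) \<and>
         (\<forall>F\<subseteq>p. finite F \<longrightarrow> (\<exists>e. realizes M e F)) \<and>
         (\<forall>\<phi>\<in>formulas L (V <+> A). \<phi> \<in> p \<or> Neg \<phi> \<in> p)}"

text \<open>
  \<open>S_y(\<emptyset>)\<close> for \<open>y = (y_0, \<dots>, y_{m-1})\<close>. It depends only on the complete theory of \<open>M\<close>.
\<close>

definition types0 ::
    "('f, 'r) lang \<Rightarrow> ('f, 'r, 'a) struct \<Rightarrow> nat \<Rightarrow> ('f, 'r, nat) fm set set" where
  "types0 L M m = {q. rename Inl ` q \<in> complete_types L M {..<m} {}}"

definition aleph0_saturated :: "('f, 'r) lang \<Rightarrow> ('f, 'r, 'a) struct \<Rightarrow> bool" where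
  "aleph0_saturated L M \<longleftrightarrow>
     (\<forall>A. finite A \<longrightarrow>
        (\<forall>p\<in>complete_types L M (UNIV :: unit set) A. \<exists>e. realizes M e p))"

definition automorphisms :: "('f, 'r) lang \<Rightarrow> ('f, 'r, 'a) struct \<Rightarrow> ('a \<Rightarrow> 'a) set" where
  "automorphisms L M =
     {\<sigma>. bij \<sigma> \<and>
         (\<forall>f as. farity L f = Some (length as) \<longrightarrow> \<sigma> (fint M f as) = fint M f (map \<sigma> as)) \<and>
         (\<forall>r as. rarity L r = Some (length as) \<longrightarrow> (rint M r (map \<sigma> as) \<longleftrightarrow> rint M r as))}"

definition tp :: "('f, 'r) lang \<Rightarrow> ('f, 'r, 'a) struct \<Rightarrow> 'a list \<Rightarrow> ('f, 'r, nat) fm set" where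
  "tp L M as = {\<phi> \<in> formulas L {..<length as}. sat M (nth as) [] \<phi>}"

definition strongly_aleph0_homogeneous :: "('f, 'r) lang \<Rightarrow> ('f, 'r, 'a) struct \<Rightarrow> bool" where
  "strongly_aleph0_homogeneous L M \<longleftrightarrow>
     (\<forall>as bs. length as = length bs \<and> tp L M as = tp L M bs \<longrightarrow>
        (\<exists>\<sigma>\<in>automorphisms L M. map \<sigma> as = bs))"

section \<open>The flow on the type space and its Ellis semigroup\<close>

text \<open>The tuple \<open>x\<close> is indexed by the type \<open>'x\<close>, which may be finite or infinite.\<close>

definition S_X ::
    "('f, 'r) lang \<Rightarrow> ('f, 'r, 'x) fm set \<Rightarrow> ('f, 'r, 'a) struct \<Rightarrow> ('f, 'r, 'x + 'a) fm set set" where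
  "S_X L \<pi> M = {p \<in> complete_types L M UNIV UNIV. rename Inl ` \<pi> \<subseteq> p}"

definition type_topology ::
    "('f, 'r) lang \<Rightarrow> ('f, 'r, 'x) fm set \<Rightarrow> ('f, 'r, 'a) struct \<Rightarrow> ('f, 'r, 'x + 'a) fm set topology" where
  "type_topology L \<pi> M =
     topology_generated_by ((\<lambda>\<phi>. {p \<in> S_X L \<pi> M. \<phi> \<in> p}) ` formulas L UNIV)"

definition act :: "('a \<Rightarrow> 'a) \<Rightarrow> ('f, 'r, 'x + 'a) fm set \<Rightarrow> ('f, 'r, 'x + 'a) fm set" where
  "act \<sigma> p = rename (map_sum id \<sigma>) ` p"

text \<open>
  Self-maps of \<open>S_X\<close> are extensional functions, and the semigroup operation is \<open>compose (S_X L \<pi> M)\<close>.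
\<close>

definition ellis ::
    "('f, 'r) lang \<Rightarrow> ('f, 'r, 'x) fm set \<Rightarrow> ('f, 'r, 'a) struct \<Rightarrow>
     (('f, 'r, 'x + 'a) fm set \<Rightarrow> ('f, 'r, 'x + 'a) fm set) set" where
  "ellis L \<pi> M =
     product_topology (\<lambda>_. type_topology L \<pi> M) (S_X L \<pi> M)
       closure_of ((\<lambda>\<sigma>. restrict (act \<sigma>) (S_X L \<pi> M)) ` automorphisms L M)"

definition left_ideal :: "('s \<Rightarrow> 's \<Rightarrow> 's) \<Rightarrow> 's set \<Rightarrow> 's set \<Rightarrow> bool" where
  "left_ideal mul E I \<longleftrightarrow> I \<noteq> {} \<and> I \<subseteq> E \<and> (\<forall>f\<in>E. \<forall>g\<in>I. mul f g \<in> I)"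

definition minimal_left_ideal :: "('s \<Rightarrow> 's \<Rightarrow> 's) \<Rightarrow> 's set \<Rightarrow> 's set \<Rightarrow> bool" where
  "minimal_left_ideal mul E I \<longleftrightarrow>
     left_ideal mul E I \<and> (\<forall>I'. left_ideal mul E I' \<and> I' \<subseteq> I \<longrightarrow> I' = I)"

section \<open>Infinitary definability patterns\<close>

text \<open>\<open>inst b \<phi>\<close> is \<open>\<phi>(x, b)\<close>, where the variable \<open>y_i\<close> of \<open>\<phi>(x, y)\<close> is \<open>Var (Inr i)\<close>.\<close>

definition inst :: "'a list \<Rightarrow> ('f, 'r, 'x + nat) fm \<Rightarrow> ('f, 'r, 'x + 'a) fm" where
  "inst b \<phi> = rename (map_sum id (nth b)) \<phi>"

definition pattern_rel ::
    "('f, 'r, 'a) struct \<Rightarrow> nat \<Rightarrow> ('f, 'r, 'x + nat) fm list \<Rightarrow> ('f, 'r, nat) fm set \<Rightarrow>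
     ('f, 'r, 'x + 'a) fm set list \<Rightarrow> bool" where
  "pattern_rel M m \<phi>s q ps \<longleftrightarrow>
     \<not> (\<exists>b. length b = m \<and> (\<forall>\<psi>\<in>q. sat M (nth b) [] \<psi>) \<and>
            (\<forall>i<length \<phi>s. inst b (\<phi>s ! i) \<in> ps ! i))"

text \<open>
  For elementarily equivalent \<open>M\<close> and \<open>N\<close> the sets \<open>types0 L M m\<close> and \<open>types0 L N m\<close> are equal, so
  both structures interpret the same relation symbols.
\<close>

definition pattern_iso ::
    "('f, 'r) lang \<Rightarrow> ('f, 'r, 'a) struct \<Rightarrow> ('f, 'r, 'b) struct \<Rightarrow>
     ('f, 'r, 'x + 'a) fm set set \<Rightarrow> ('f, 'r, 'x + 'b) fm set set \<Rightarrow>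
     (('f, 'r, 'x + 'a) fm set \<Rightarrow> ('f, 'r, 'x + 'b) fm set) \<Rightarrow> bool" where
  "pattern_iso L M N J K h \<longleftrightarrow>
     bij_betw h J K \<and>
     (\<forall>m. \<forall>\<phi>s q ps.
        \<phi>s \<noteq> [] \<and> set \<phi>s \<subseteq> formulas L (UNIV <+> {..<m}) \<and>
        q \<in> types0 L M m \<union> types0 L N m \<and>
        length ps = length \<phi>s \<and> set ps \<subseteq> J \<longrightarrow>
        (pattern_rel M m \<phi>s q ps \<longleftrightarrow> pattern_rel N m \<phi>s q (map h ps)))"

end

theory Submission
  imports Defs
begin

text \<open>
  Say that a map between type spaces is a homomorphism if it preserves all relations
  \<open>R\<close>. By strong homogeneity, the Ellis semigroup of \<open>S_X(C)\<close> is exactly the semigroup of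
  endomorphisms of \<open>S_X(C)\<close>. By saturation and compactness there are homomorphisms \<open>f\<close> and \<open>g\<close> between
  \<open>S_X(C1)\<close> and \<open>S_X(C2)\<close> in both directions. Then \<open>u1 g u2 f u1\<close> and \<open>u2 f u1 g u2\<close> are elements of
  the groups \<open>u1 M1\<close> and \<open>u2 M2\<close>, hence invertible there, so \<open>u2 f\<close> restricts to a bijection
  from \<open>Im u1\<close> to \<open>Im u2\<close> whose inverse is again a homomorphism.
\<close>

section \<open>Syntax and satisfaction\<close>

text \<open>The two models may have different cardinalities, and neither need embed elementarily in
  the other, since saturation controls only finite parameter sets. A comparison map can thus only be
  assembled from type preserving maps on finite sets of parameters, with no coherence among them;
  the limit is taken on the side of the types, where compactness is available. Parameters travel
  against the map: for \<open>f\<close> from types over \<open>M\<close> to types over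
  \<open>N\<close>, finite subsets of \<open>N\<close> are moved into \<open>M\<close>.
  Homomorphisms are therefore described by finite configurations involving several types at once.
  This is also exactly what a basic neighbourhood in the product topology sees, so membership in the
  Ellis semigroup becomes a condition that survives a detour through the other model:
  \<open>u1 g u2 f u1\<close> lies in the semigroup of \<open>C1\<close> although \<open>f\<close>
  and \<open>g\<close> come from no automorphism. The inverse found in the group is again a member
  of the semigroup, hence a homomorphism; this is why the relations are reflected and not only
  preserved.\<close>

lemma finite_fv_tm: "finite (fv_tm t)"
  by (induction t) auto

lemma finite_fv: "finite (fv \<phi>)"
  by (induction \<phi>) (auto simp: finite_fv_tm)

lemma val_rename: "val M e bs (rename_tm f t) = val M (e \<circ> f) bs t"
  by (induction t) (auto simp: comp_def cong: map_cong)

lemma sat_rename: "sat M e bs (rename f \<phi>) \<longleftrightarrow> sat M (e \<circ> f) bs \<phi>"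
  by (induction \<phi> arbitrary: bs) (auto simp: val_rename comp_def)

lemma val_cong: "(\<And>v. v \<in> fv_tm t \<Longrightarrow> e v = e' v) \<Longrightarrow> val M e bs t = val M e' bs t"
proof (induction t)
  case (Fun f ts)
  then have "map (val M e bs) ts = map (val M e' bs) ts"
    by (intro map_cong) auto
  then show ?case by (metis val.simps(3))
qed auto

lemma sat_cong:
  "(\<And>v. v \<in> fv \<phi> \<Longrightarrow> e v = e' v) \<Longrightarrow> sat M e bs \<phi> \<longleftrightarrow> sat M e' bs \<phi>"
proof (induction \<phi> arbitrary: bs)
  case (Eq s t)
  then show ?case using val_cong[of s e e' M bs] val_cong[of t e e' M bs] by auto
next
  case (Rel r ts)
  then have "map (val M e bs) ts = map (val M e' bs) ts"
    by (intro map_cong) (auto intro!: val_cong)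
  then show ?case by (metis sat.simps(3))
qed auto

lemma wf_tm_rename: "wf_tm L k (rename_tm f t) = wf_tm L k t"
  by (induction t) auto

lemma wf_fm_rename: "wf_fm L k (rename f \<phi>) = wf_fm L k \<phi>"
  by (induction \<phi> arbitrary: k) (auto simp: wf_tm_rename)

lemma rename_in_formulas_iff: "rename f \<phi> \<in> formulas L V \<longleftrightarrow> \<phi> \<in> formulas L (f -` V)"
  by (auto simp: formulas_def wf_fm_rename fm.set_map)

lemma rename_in_formulas: "\<phi> \<in> formulas L V \<Longrightarrow> f ` V \<subseteq> W \<Longrightarrow> rename f \<phi> \<in> formulas L W"
  by (auto simp: formulas_def wf_fm_rename fm.set_map)

lemma formulas_mono: "V \<subseteq> W \<Longrightarrow> formulas L V \<subseteq> formulas L W"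
  by (auto simp: formulas_def)

lemma Neg_in_formulas [simp]: "Neg \<phi> \<in> formulas L V \<longleftrightarrow> \<phi> \<in> formulas L V"
  by (auto simp: formulas_def Neg_def)

lemma rename_Neg [simp]: "rename f (Neg \<phi>) = Neg (rename f \<phi>)"
  by (simp add: Neg_def)

lemma sat_Neg [simp]: "sat M e bs (Neg \<phi>) \<longleftrightarrow> \<not> sat M e bs \<phi>"
  by (simp add: Neg_def)

section \<open>Quantification over finitely many named variables\<close>

fun bind_tm :: "'v \<Rightarrow> nat \<Rightarrow> ('f, 'v) tm \<Rightarrow> ('f, 'v) tm" where
  "bind_tm v k (Var w) = (if w = v then Bnd k else Var w)"
| "bind_tm v k (Bnd n) = Bnd n"
| "bind_tm v k (Fun f ts) = Fun f (map (bind_tm v k) ts)"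

fun bind_fm :: "'v \<Rightarrow> nat \<Rightarrow> ('f, 'r, 'v) fm \<Rightarrow> ('f, 'r, 'v) fm" where
  "bind_fm v k Bot = Bot"
| "bind_fm v k (Eq s t) = Eq (bind_tm v k s) (bind_tm v k t)"
| "bind_fm v k (Rel r ts) = Rel r (map (bind_tm v k) ts)"
| "bind_fm v k (Imp \<phi> \<psi>) = Imp (bind_fm v k \<phi>) (bind_fm v k \<psi>)"
| "bind_fm v k (All \<phi>) = All (bind_fm v (Suc k) \<phi>)"

lemma wf_bind_tm: "wf_tm L k t \<Longrightarrow> wf_tm L (Suc k) (bind_tm v k t)"
  by (induction t) auto

lemma wf_bind_fm: "wf_fm L k \<phi> \<Longrightarrow> wf_fm L (Suc k) (bind_fm v k \<phi>)"
  by (induction \<phi> arbitrary: k) (auto simp: wf_bind_tm)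

lemma fv_bind_tm: "fv_tm (bind_tm v k t) = fv_tm t - {v}"
  by (induction t) auto

lemma fv_bind_fm: "fv (bind_fm v k \<phi>) = fv \<phi> - {v}"
  by (induction \<phi> arbitrary: k) (auto simp: fv_bind_tm)

text \<open>Values of bound variables are listed innermost first, so the new outermost quantifier,
  which has index \<open>length bs\<close> under \<open>length bs\<close> binders, finds its value
  at the end of the list. Well-formedness keeps all old indices below \<open>length bs\<close>,
  where appending \<open>a\<close> changes nothing.\<close>

lemma val_bind_tm:
  "wf_tm L (length bs) t \<Longrightarrow> val M e (bs @ [a]) (bind_tm v (length bs) t) = val M (e(v := a)) bs t"
proof (induction t)
  case (Fun f ts)
  then have "map (val M e (bs @ [a]) \<circ> bind_tm v (length bs)) ts = map (val M (e(v := a)) bs) ts"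
    by (intro map_cong) (auto simp del: fun_upd_apply)
  then show ?case by (simp only: bind_tm.simps val.simps map_map)
qed (auto simp: nth_append)

lemma sat_bind_fm:
  "wf_fm L (length bs) \<phi> \<Longrightarrow>
     sat M e (bs @ [a]) (bind_fm v (length bs) \<phi>) \<longleftrightarrow> sat M (e(v := a)) bs \<phi>"
proof (induction \<phi> arbitrary: bs)
  case (Rel r ts)
  then have "map (val M e (bs @ [a]) \<circ> bind_tm v (length bs)) ts = map (val M (e(v := a)) bs) ts"
    by (intro map_cong) (auto simp: val_bind_tm simp del: fun_upd_apply)
  then show ?case by (simp only: bind_fm.simps sat.simps map_map)
next
  case (All \<phi>)
  have "sat M e ((c # bs) @ [a]) (bind_fm v (length (c # bs)) \<phi>) \<longleftrightarrow> sat M (e(v := a)) (c # bs) \<phi>" for c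
    using All.prems by (intro All.IH) simp
  then show ?case by (simp del: fun_upd_apply)
qed (auto simp: val_bind_tm simp del: fun_upd_apply)

definition all_vars :: "'v list \<Rightarrow> ('f, 'r, 'v) fm \<Rightarrow> ('f, 'r, 'v) fm" where
  "all_vars vs \<phi> = foldr (\<lambda>v \<psi>. All (bind_fm v 0 \<psi>)) vs \<phi>"

lemma all_vars_in_formulas:
  "\<phi> \<in> formulas L (V \<union> set vs) \<Longrightarrow> all_vars vs \<phi> \<in> formulas L V"
proof (induction vs arbitrary: V)
  case (Cons v vs)
  then have "all_vars vs \<phi> \<in> formulas L (insert v V)" by simp
  then show ?case by (auto simp: all_vars_def formulas_def fv_bind_fm wf_bind_fm)
qed (simp add: all_vars_def)

lemma sat_all_vars:
  assumes "wf_fm L 0 \<phi>"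
  shows "sat M e [] (all_vars vs \<phi>) \<longleftrightarrow> (\<forall>d. (\<forall>v. v \<notin> set vs \<longrightarrow> d v = e v) \<longrightarrow> sat M d [] \<phi>)"
proof (induction vs arbitrary: e)
  case Nil
  have "d = e" if "\<forall>v. d v = e v" for d using that by auto
  then show ?case by (auto simp: all_vars_def)
next
  case (Cons v vs)
  have "wf_fm L 0 (all_vars vs \<phi>)"
    using all_vars_in_formulas[of \<phi> L UNIV vs] assms by (simp add: formulas_def)
  then have "sat M e [a] (bind_fm v 0 (all_vars vs \<phi>)) \<longleftrightarrow> sat M (e(v := a)) [] (all_vars vs \<phi>)" for a
    using sat_bind_fm[of L "[]" "all_vars vs \<phi>" M e a v] by simp
  then have "sat M e [] (all_vars (v # vs) \<phi>) \<longleftrightarrow> (\<forall>a. sat M (e(v := a)) [] (all_vars vs \<phi>))"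
    by (simp add: all_vars_def del: fun_upd_apply)
  also have "\<dots> \<longleftrightarrow> (\<forall>a d. (\<forall>w. w \<notin> set vs \<longrightarrow> d w = (e(v := a)) w) \<longrightarrow> sat M d [] \<phi>)"
    using Cons.IH by blast
  also have "\<dots> \<longleftrightarrow> (\<forall>d. (\<forall>w. w \<notin> set (v # vs) \<longrightarrow> d w = e w) \<longrightarrow> sat M d [] \<phi>)" (is "?l \<longleftrightarrow> ?r")
  proof
    assume l: ?l
    show ?r
    proof (intro allI impI)
      fix d assume "\<forall>w. w \<notin> set (v # vs) \<longrightarrow> d w = e w"
      then show "sat M d [] \<phi>" using l[rule_format, of d "d v"] by auto
    qed
  next
    assume r: ?r
    show ?l
    proof (intro allI impI)
      fix a d assume "\<forall>w. w \<notin> set vs \<longrightarrow> d w = (e(v := a)) w"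
      then show "sat M d [] \<phi>" using r[rule_format, of d] by auto
    qed
  qed
  finally show ?case .
qed

text \<open>A negated finite conjunction. The negation of
  \<open>all_vars vs (refute_all \<phi>s)\<close> is thus the existential statement that some choice
  of values for \<open>vs\<close> satisfies all of \<open>\<phi>s\<close>.\<close>

definition refute_all :: "('f, 'r, 'v) fm list \<Rightarrow> ('f, 'r, 'v) fm" where
  "refute_all \<phi>s = foldr Imp \<phi>s Bot"

lemma sat_refute_all: "sat M e bs (refute_all \<phi>s) \<longleftrightarrow> \<not> (\<forall>\<phi>\<in>set \<phi>s. sat M e bs \<phi>)"
  by (induction \<phi>s) (auto simp: refute_all_def)

lemma refute_all_in_formulas: "set \<phi>s \<subseteq> formulas L V \<Longrightarrow> refute_all \<phi>s \<in> formulas L V"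
  by (induction \<phi>s) (auto simp: refute_all_def formulas_def)

section \<open>Elementary equivalence of assignments\<close>

text \<open>The index type of the variables is left free. With the elements of a model as variables,
  \<open>same_type L N id M \<theta> B\<close> says that \<open>\<theta>\<close> is a partial
  elementary map from \<open>B\<close> into \<open>M\<close>; with natural numbers it compares types
  of tuples.\<close>

definition same_type ::
    "('f, 'r) lang \<Rightarrow> ('f, 'r, 'a) struct \<Rightarrow> ('v \<Rightarrow> 'a) \<Rightarrow> ('f, 'r, 'b) struct \<Rightarrow> ('v \<Rightarrow> 'b) \<Rightarrow> 'v set \<Rightarrow> bool"
  where "same_type L M e N e' W \<longleftrightarrow> (\<forall>\<phi>\<in>formulas L W. sat M e [] \<phi> \<longleftrightarrow> sat N e' [] \<phi>)"

lemma same_typeD: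
  "same_type L M e N e' W \<Longrightarrow> \<phi> \<in> formulas L W \<Longrightarrow> sat M e [] \<phi> \<longleftrightarrow> sat N e' [] \<phi>"
  by (simp add: same_type_def)

lemma same_type_sym: "same_type L M e N e' W \<Longrightarrow> same_type L N e' M e W"
  by (simp add: same_type_def)

lemma same_type_trans:
  "same_type L M e N e' W \<Longrightarrow> same_type L N e' P e'' W \<Longrightarrow> same_type L M e P e'' W"
  by (simp add: same_type_def)

lemma same_type_mono: "same_type L M e N e' W \<Longrightarrow> V \<subseteq> W \<Longrightarrow> same_type L M e N e' V"
  unfolding same_type_def using formulas_mono by blast

lemma same_type_comp:
  assumes "same_type L M e N e' W" "f ` V \<subseteq> W"
  shows "same_type L M (e \<circ> f) N (e' \<circ> f) V"
  unfolding same_type_def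
proof
  fix \<phi> :: "('a, 'b, 'f) fm" assume "\<phi> \<in> formulas L V"
  then have "rename f \<phi> \<in> formulas L W" using assms(2) by (rule rename_in_formulas)
  from same_typeD[OF assms(1) this] show "sat M (e \<circ> f) [] \<phi> \<longleftrightarrow> sat N (e' \<circ> f) [] \<phi>"
    by (simp add: sat_rename)
qed

lemma same_type_cong:
  assumes "\<And>v. v \<in> W \<Longrightarrow> e v = d v" "\<And>v. v \<in> W \<Longrightarrow> e' v = d' v"
  shows "same_type L M e N e' W \<longleftrightarrow> same_type L M d N d' W"
proof -
  have "sat M e [] \<phi> \<longleftrightarrow> sat M d [] \<phi>" "sat N e' [] \<phi> \<longleftrightarrow> sat N d' [] \<phi>"
    if "\<phi> \<in> formulas L W" for \<phi> using that assms by (auto intro!: sat_cong simp: formulas_def)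
  then show ?thesis by (auto simp: same_type_def)
qed

lemma same_type_tp:
  assumes "length as = length bs"
  shows "tp L M as = tp L N bs \<longleftrightarrow> same_type L M (nth as) N (nth bs) {..<length as}"
  using assms by (auto simp: tp_def same_type_def)

text \<open>Only finitely many variables outside \<open>W\<close> occur in \<open>F\<close>.
  Quantifying them existentially gives one formula over \<open>W\<close>, true under
  \<open>e\<close> and hence under \<open>e'\<close>; its witnesses in \<open>N\<close> form
  \<open>d'\<close>.\<close>

lemma same_type_transfer:
  assumes st: "same_type L M e N e' W"
    and F: "finite F" "F \<subseteq> formulas L UNIV"
    and d: "\<And>v. v \<in> W \<Longrightarrow> d v = e v" "\<And>\<phi>. \<phi> \<in> F \<Longrightarrow> sat M d [] \<phi>"
  obtains d' where "\<And>v. v \<in> W \<Longrightarrow> d' v = e' v" "\<And>\<phi>. \<phi> \<in> F \<Longrightarrow> sat N d' [] \<phi>"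
proof -
  obtain \<phi>s where \<phi>s: "set \<phi>s = F" using finite_list[OF F(1)] by blast
  have "finite ((\<Union>\<phi>\<in>F. fv \<phi>) - W)" using F(1) by (simp add: finite_fv)
  then obtain vs where vs: "set vs = (\<Union>\<phi>\<in>F. fv \<phi>) - W" using finite_list by blast
  let ?\<psi> = "refute_all \<phi>s"
  have \<psi>: "?\<psi> \<in> formulas L (W \<union> set vs)"
    using F(2) by (intro refute_all_in_formulas) (auto simp: \<phi>s vs formulas_def)
  then have wf: "wf_fm L 0 ?\<psi>" by (simp add: formulas_def)
  \<comment> \<open>The quantified formula sees only assignments agreeing with \<open>e\<close> off
    \<open>vs\<close>, whereas \<open>d\<close> may differ from \<open>e\<close> at irrelevant
    variables outside \<open>W\<close>.\<close>
  let ?d = "\<lambda>v. if v \<in> set vs then d v else e v"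
  have eq: "d v = ?d v" if "v \<in> fv \<phi>" "\<phi> \<in> F" for v \<phi>
    using that d(1) vs by (cases "v \<in> W") auto
  have "sat M ?d [] \<phi>" if "\<phi> \<in> F" for \<phi>
    using d(2)[OF that] sat_cong[of \<phi> d ?d M "[]"] eq that by blast
  then have "\<not> sat M ?d [] ?\<psi>" by (simp add: sat_refute_all \<phi>s)
  then have "\<not> sat M e [] (all_vars vs ?\<psi>)" unfolding sat_all_vars[OF wf]
    by (intro notI) (drule spec[where x = ?d], simp)
  then have "\<not> sat N e' [] (all_vars vs ?\<psi>)"
    using same_typeD[OF st all_vars_in_formulas[OF \<psi>]] by simp
  then obtain d' where "\<forall>v. v \<notin> set vs \<longrightarrow> d' v = e' v" "\<not> sat N d' [] ?\<psi>"
    unfolding sat_all_vars[OF wf] by blast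
  then show thesis using that[of d'] by (auto simp: sat_refute_all \<phi>s vs)
qed

text \<open>The sentences of \<open>T\<close> use natural numbers as variables, and
  \<open>\<phi>\<close> uses another type. Since \<open>\<phi>\<close> has no free variables,
  renaming by a constant map turns it into a sentence decided by \<open>T\<close> without changing
  its truth value.\<close>

lemma same_type_complete_theory:
  fixes T :: "('f, 'r, nat) fm set" and e :: "'v \<Rightarrow> 'a" and e' :: "'v \<Rightarrow> 'b"
  assumes "complete_theory L T" "models M T" "models N T"
  shows "same_type L M e N e' {}"
  unfolding same_type_def
proof
  fix \<phi> :: "('f, 'r, 'v) fm" assume \<phi>: "\<phi> \<in> formulas L {}"
  let ?\<psi> = "rename (\<lambda>_. 0) \<phi> :: ('f, 'r, nat) fm"
  have sat: "sat P d [] ?\<psi> \<longleftrightarrow> sat P d' [] \<phi>" for P :: "('f, 'r, 'z) struct" and d d'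
    unfolding sat_rename using \<phi> by (intro sat_cong) (auto simp: formulas_def)
  have "?\<psi> \<in> formulas L {}" using \<phi> by (rule rename_in_formulas) simp
  then have "(?\<psi> \<in> T) \<noteq> (Neg ?\<psi> \<in> T)"
    using assms(1) unfolding complete_theory_def by blast
  then consider "?\<psi> \<in> T" | "Neg ?\<psi> \<in> T" by blast
  then show "sat M e [] \<phi> \<longleftrightarrow> sat N e' [] \<phi>"
  proof cases
    case 1
    then have "sat M (\<lambda>_. undefined) [] ?\<psi>" "sat N (\<lambda>_. undefined) [] ?\<psi>"
      using assms(2,3) by (auto simp: models_def)
    then show ?thesis using sat[of M _ e] sat[of N _ e'] by simp
  next
    case 2
    then have "sat M (\<lambda>_. undefined) [] (Neg ?\<psi>)" "sat N (\<lambda>_. undefined) [] (Neg ?\<psi>)"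
      using assms(2,3) by (auto simp: models_def)
    then show ?thesis using sat[of M _ e] sat[of N _ e'] by simp
  qed
qed

section \<open>Complete types\<close>

lemma complete_typesD:
  assumes "p \<in> complete_types L M V A"
  shows "p \<subseteq> formulas L (V <+> A)"
    and "\<And>F. F \<subseteq> p \<Longrightarrow> finite F \<Longrightarrow> \<exists>e. realizes M e F"
    and "\<And>\<phi>. \<phi> \<in> formulas L (V <+> A) \<Longrightarrow> \<phi> \<in> p \<or> Neg \<phi> \<in> p"
  using assms by (auto simp: complete_types_def)

text \<open>Otherwise completeness puts \<open>Neg \<phi>\<close> into \<open>p\<close>, and finite
  satisfiability realizes it together with \<open>F\<close>.\<close>

lemma complete_types_closed:
  assumes p: "p \<in> complete_types L M V A" and F: "F \<subseteq> p" "finite F"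
    and \<phi>: "\<phi> \<in> formulas L (V <+> A)"
    and imp: "\<And>e. realizes M e F \<Longrightarrow> sat M (case_sum e id) [] \<phi>"
  shows "\<phi> \<in> p"
proof (rule ccontr)
  assume "\<phi> \<notin> p"
  then have "insert (Neg \<phi>) F \<subseteq> p" using complete_typesD(3)[OF p \<phi>] F(1) by simp
  then obtain e where "realizes M e (insert (Neg \<phi>) F)"
    using complete_typesD(2)[OF p] F(2) by (meson finite_insert)
  then show False using imp[of e] by (simp add: realizes_def)
qed

definition Conj :: "('f, 'r, 'v) fm \<Rightarrow> ('f, 'r, 'v) fm \<Rightarrow> ('f, 'r, 'v) fm" where
  "Conj \<phi> \<psi> = Neg (Imp \<phi> (Neg \<psi>))"

lemma sat_Conj [simp]: "sat M e bs (Conj \<phi> \<psi>) \<longleftrightarrow> sat M e bs \<phi> \<and> sat M e bs \<psi>"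
  by (simp add: Conj_def)

lemma Conj_in_formulas [simp]:
  "Conj \<phi> \<psi> \<in> formulas L V \<longleftrightarrow> \<phi> \<in> formulas L V \<and> \<psi> \<in> formulas L V"
  by (auto simp: formulas_def Conj_def Neg_def)

lemma Conj_in_complete_type:
  assumes p: "p \<in> complete_types L M V A"
    and "\<phi> \<in> formulas L (V <+> A)" "\<psi> \<in> formulas L (V <+> A)"
  shows "Conj \<phi> \<psi> \<in> p \<longleftrightarrow> \<phi> \<in> p \<and> \<psi> \<in> p"
proof
  assume "Conj \<phi> \<psi> \<in> p"
  then have F: "{Conj \<phi> \<psi>} \<subseteq> p" "finite {Conj \<phi> \<psi>}" by auto
  show "\<phi> \<in> p \<and> \<psi> \<in> p"
    by (intro conjI complete_types_closed[OF p F]) (auto simp: realizes_def assms(2,3))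
next
  assume "\<phi> \<in> p \<and> \<psi> \<in> p"
  then have F: "{\<phi>, \<psi>} \<subseteq> p" "finite {\<phi>, \<psi>}" by auto
  show "Conj \<phi> \<psi> \<in> p"
    by (intro complete_types_closed[OF p F]) (auto simp: realizes_def assms(2,3))
qed

lemma S_X_complete_types: "p \<in> S_X L \<pi> M \<Longrightarrow> p \<in> complete_types L M UNIV UNIV"
  by (simp add: S_X_def)

section \<open>Realizing finite types in a saturated model\<close>

lemma same_type_extend:
  fixes C :: "('f, 'r, 'a) struct" and D :: "('f, 'r, 'b) struct" and \<theta> :: "'b \<Rightarrow> 'a"
  assumes sat: "aleph0_saturated L C" and fin: "finite A"
    and st: "same_type L D id C \<theta> A"
  obtains c where "same_type L D id C (\<theta>(d := c)) (insert d A)"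
proof (cases "d \<in> A")
  case True
  then show thesis using that[of "\<theta> d"] st by (simp add: insert_absorb)
next
  case False
  \<comment> \<open>Equality is itself a formula, so \<open>\<theta>\<close> can be inverted on
    \<open>A\<close> and parameters from the image can be read back in \<open>D\<close>.\<close>
  have inj: "inj_on \<theta> A"
  proof (rule inj_onI)
    fix a a' assume "a \<in> A" "a' \<in> A" "\<theta> a = \<theta> a'"
    then show "a = a'" using same_typeD[OF st, of "Eq (Var a) (Var a')"] by (simp add: formulas_def)
  qed
  let ?\<rho> = "inv_into A \<theta>"
  let ?e = "case_sum (\<lambda>_. d) ?\<rho> :: unit + 'a \<Rightarrow> 'b"
  have \<rho>: "?\<rho> ` \<theta> ` A \<subseteq> A" by (auto intro: inv_into_into)
  define p where "p = {\<phi> \<in> formulas L ((UNIV :: unit set) <+> \<theta> ` A). sat D ?e [] \<phi>}"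
  have "same_type L D (id \<circ> ?\<rho>) C (\<theta> \<circ> ?\<rho>) (\<theta> ` A)"
    using st \<rho> by (rule same_type_comp)
  then have "same_type L D ?\<rho> C id (\<theta> ` A)"
    by (subst (asm) same_type_cong[of _ _ ?\<rho> _ id]) (auto simp: f_inv_into_f)
  moreover have "case_sum undefined id ` Inr ` \<theta> ` A \<subseteq> \<theta> ` A" by auto
  ultimately have "same_type L D (?\<rho> \<circ> case_sum undefined id) C (id \<circ> case_sum undefined id)
      (Inr ` \<theta> ` A :: (unit + 'a) set)"
    by (rule same_type_comp)
  then have st': "same_type L D ?e C (case_sum undefined id) (Inr ` \<theta> ` A :: (unit + 'a) set)"
    by (subst (asm) same_type_cong[of _ _ ?e _ "case_sum undefined id"]) auto
  have "p \<in> complete_types L C UNIV (\<theta> ` A)"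
    unfolding complete_types_def
  proof (intro CollectI conjI allI impI ballI)
    fix F assume F: "F \<subseteq> p" "finite F"
    have "F \<subseteq> formulas L UNIV" using F(1) formulas_mono[OF subset_UNIV] by (auto simp: p_def)
    then obtain e' where e': "\<And>v. v \<in> Inr ` \<theta> ` A \<Longrightarrow> e' v = case_sum undefined id v"
        "\<And>\<phi>. \<phi> \<in> F \<Longrightarrow> sat C e' [] \<phi>"
      using same_type_transfer[OF st' F(2), of ?e] F(1) by (auto simp: p_def subset_eq)
    have "sat C (case_sum (e' \<circ> Inl) id) [] \<phi>" if "\<phi> \<in> F" for \<phi>
    proof -
      have "case_sum (e' \<circ> Inl) id v = e' v" if "v \<in> fv \<phi>" for v
      proof -
        have "v \<in> UNIV <+> \<theta> ` A" using that \<open>\<phi> \<in> F\<close> F(1) by (auto simp: p_def formulas_def)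
        then show ?thesis using e'(1)[of v] by auto
      qed
      then show ?thesis using e'(2)[OF \<open>\<phi> \<in> F\<close>] sat_cong by metis
    qed
    then show "\<exists>e. realizes C e F" by (auto simp: realizes_def)
  qed (auto simp: p_def)
  then obtain e where e: "realizes C e p"
    using sat fin unfolding aleph0_saturated_def by (metis finite_imageI)
  have iff: "sat D ?e [] \<phi> \<longleftrightarrow> sat C (case_sum e id) [] \<phi>"
    if "\<phi> \<in> formulas L (UNIV <+> \<theta> ` A)" for \<phi>
  proof -
    have "sat C (case_sum e id) [] \<psi>" if "\<psi> \<in> p" for \<psi>
      using e that by (simp add: realizes_def)
    from this[of \<phi>] this[of "Neg \<phi>"] show ?thesis using that by (auto simp: p_def)
  qed
  then have "same_type L D ?e C (case_sum e id) (UNIV <+> \<theta> ` A)" by (simp add: same_type_def)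
  moreover define g where "g = (\<lambda>a. if a = d then Inl () else Inr (\<theta> a))"
  moreover have "g ` insert d A \<subseteq> UNIV <+> \<theta> ` A" by (auto simp: g_def)
  ultimately have "same_type L D (?e \<circ> g) C (case_sum e id \<circ> g) (insert d A)"
    by (blast intro: same_type_comp)
  then have "same_type L D id C (\<theta>(d := e ())) (insert d A)"
    using inj by (subst (asm) same_type_cong[of _ _ id _ "\<theta>(d := e ())"]) (auto simp: g_def)
  then show thesis by (rule that)
qed

lemma same_type_realized:
  fixes T :: "('f, 'r, nat) fm set"
  assumes "complete_theory L T" "models C T" "models D T" "aleph0_saturated L C" "finite A"
  shows "\<exists>\<theta>. same_type L D id C \<theta> A"
  using assms(5)
proof induction
  case empty
  then show ?case using same_type_complete_theory[OF assms(1,3,2)] by blast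
next
  case (insert d A)
  then obtain \<theta> where "same_type L D id C \<theta> A" by blast
  from same_type_extend[OF assms(4) insert.hyps(1) this] show ?case by blast
qed

section \<open>Homomorphisms of definability patterns structures\<close>

text \<open>
  A homomorphism preserves the relations \<open>R\<close>, which is stated here contrapositively: every
  configuration found in the image with parameters \<open>B\<close> is found in the source with parameters
  of the same type.
\<close>

definition pattern_hom ::
    "('f, 'r) lang \<Rightarrow> ('f, 'r, 'x) fm set \<Rightarrow> ('f, 'r, 'a) struct \<Rightarrow> ('f, 'r, 'b) struct \<Rightarrow>
     (('f, 'r, 'x + 'a) fm set \<Rightarrow> ('f, 'r, 'x + 'b) fm set) \<Rightarrow> bool" where
  "pattern_hom L \<pi> M N f \<longleftrightarrow>
     f \<in> S_X L \<pi> M \<rightarrow> S_X L \<pi> N \<and>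
     (\<forall>B K. finite B \<and> finite K \<and> K \<subseteq> S_X L \<pi> M \<times> formulas L (UNIV <+> B) \<and>
            (\<forall>(p, \<phi>)\<in>K. \<phi> \<in> f p) \<longrightarrow>
        (\<exists>\<theta>. same_type L N id M \<theta> B \<and> (\<forall>(p, \<phi>)\<in>K. rename (map_sum id \<theta>) \<phi> \<in> p)))"

lemma pattern_homD:
  assumes "pattern_hom L \<pi> M N f" "finite B" "finite K"
    "K \<subseteq> S_X L \<pi> M \<times> formulas L (UNIV <+> B)" "\<And>p \<phi>. (p, \<phi>) \<in> K \<Longrightarrow> \<phi> \<in> f p"
  obtains \<theta> where "same_type L N id M \<theta> B" "\<And>p \<phi>. (p, \<phi>) \<in> K \<Longrightarrow> rename (map_sum id \<theta>) \<phi> \<in> p"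
proof -
  have "\<exists>\<theta>. same_type L N id M \<theta> B \<and> (\<forall>(p, \<phi>)\<in>K. rename (map_sum id \<theta>) \<phi> \<in> p)"
    using assms(1)[unfolded pattern_hom_def, THEN conjunct2, THEN spec, THEN spec, THEN mp, of B K]
      assms(2-5) by auto
  then show thesis using that by blast
qed

lemma pattern_homI:
  assumes "\<And>p. p \<in> S_X L \<pi> M \<Longrightarrow> f p \<in> S_X L \<pi> N"
    "\<And>B K. finite B \<Longrightarrow> finite K \<Longrightarrow> K \<subseteq> S_X L \<pi> M \<times> formulas L (UNIV <+> B) \<Longrightarrow>
      (\<And>p \<phi>. (p, \<phi>) \<in> K \<Longrightarrow> \<phi> \<in> f p) \<Longrightarrow>
      \<exists>\<theta>. same_type L N id M \<theta> B \<and> (\<forall>(p, \<phi>)\<in>K. rename (map_sum id \<theta>) \<phi> \<in> p)"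
  shows "pattern_hom L \<pi> M N f"
  unfolding pattern_hom_def
proof (intro conjI allI impI)
  show "f \<in> S_X L \<pi> M \<rightarrow> S_X L \<pi> N" using assms(1) by auto
  fix B K
  assume "finite B \<and> finite K \<and> K \<subseteq> S_X L \<pi> M \<times> formulas L (UNIV <+> B) \<and> (\<forall>(p, \<phi>)\<in>K. \<phi> \<in> f p)"
  then show "\<exists>\<theta>. same_type L N id M \<theta> B \<and> (\<forall>(p, \<phi>)\<in>K. rename (map_sum id \<theta>) \<phi> \<in> p)"
    by (intro assms(2)) auto
qed

lemma pattern_hom_in_S_X: "pattern_hom L \<pi> M N f \<Longrightarrow> p \<in> S_X L \<pi> M \<Longrightarrow> f p \<in> S_X L \<pi> N"
  by (auto simp: pattern_hom_def)

lemma rename_map_sum_comp: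
  "rename (map_sum id \<theta>') (rename (map_sum id \<theta>) \<phi>) = rename (map_sum id (\<theta>' \<circ> \<theta>)) \<phi>"
  by (simp add: fm.map_comp map_sum.comp)

lemma pattern_hom_compose:
  assumes f: "pattern_hom L \<pi> M N f" and g: "pattern_hom L \<pi> N P g"
  shows "pattern_hom L \<pi> M P (compose (S_X L \<pi> M) g f)"
proof (rule pattern_homI)
  fix p assume "p \<in> S_X L \<pi> M"
  then show "compose (S_X L \<pi> M) g f p \<in> S_X L \<pi> P"
    using pattern_hom_in_S_X[OF f] pattern_hom_in_S_X[OF g] by (simp add: compose_def)
next
  fix B K assume B: "finite B" and K: "finite K" "K \<subseteq> S_X L \<pi> M \<times> formulas L (UNIV <+> B)"
    and mem: "\<And>p \<phi>. (p, \<phi>) \<in> K \<Longrightarrow> \<phi> \<in> compose (S_X L \<pi> M) g f p"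
  have S: "p \<in> S_X L \<pi> M" and fm: "\<phi> \<in> formulas L (UNIV <+> B)" if "(p, \<phi>) \<in> K" for p \<phi>
    using K(2) that by auto
  obtain \<theta> where \<theta>: "same_type L P id N \<theta> B"
      "\<And>p \<phi>. (p, \<phi>) \<in> map_prod f id ` K \<Longrightarrow> rename (map_sum id \<theta>) \<phi> \<in> p"
  proof (rule pattern_homD[OF g B, of "map_prod f id ` K"])
    show "map_prod f id ` K \<subseteq> S_X L \<pi> N \<times> formulas L (UNIV <+> B)"
      using S fm pattern_hom_in_S_X[OF f] by auto
    show "\<phi> \<in> g p" if "(p, \<phi>) \<in> map_prod f id ` K" for p \<phi>
      using that mem S by (fastforce simp: compose_def)
  qed (use K(1) in auto)
  obtain \<theta>' where \<theta>': "same_type L N id M \<theta>' (\<theta> ` B)"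
      "\<And>p \<phi>. (p, \<phi>) \<in> map_prod id (rename (map_sum id \<theta>)) ` K \<Longrightarrow> rename (map_sum id \<theta>') \<phi> \<in> p"
  proof (rule pattern_homD[OF f, of "\<theta> ` B" "map_prod id (rename (map_sum id \<theta>)) ` K"])
    show "map_prod id (rename (map_sum id \<theta>)) ` K \<subseteq> S_X L \<pi> M \<times> formulas L (UNIV <+> \<theta> ` B)"
      using S by (auto intro!: rename_in_formulas[OF fm])
    show "\<phi> \<in> f p" if "(p, \<phi>) \<in> map_prod id (rename (map_sum id \<theta>)) ` K" for p \<phi>
      using that \<theta>(2) by force
  qed (use K(1) B in auto)
  have "same_type L P id M (\<theta>' \<circ> \<theta>) B"
    using same_type_trans[OF \<theta>(1)] same_type_comp[OF \<theta>'(1), of \<theta> B] by simp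
  moreover have "rename (map_sum id (\<theta>' \<circ> \<theta>)) \<phi> \<in> p" if "(p, \<phi>) \<in> K" for p \<phi>
    using \<theta>'(2)[of p "rename (map_sum id \<theta>) \<phi>"] that by (force simp: rename_map_sum_comp)
  ultimately show "\<exists>\<theta>. same_type L P id M \<theta> B \<and> (\<forall>(p, \<phi>)\<in>K. rename (map_sum id \<theta>) \<phi> \<in> p)"
    by blast
qed

text \<open>A tuple \<open>b\<close> violating the relation over \<open>N\<close> yields the
  configuration of pairs \<open>(ps ! i, inst b (\<phi>s ! i))\<close>. Moving it to
  \<open>M\<close> makes \<open>map \<theta> b\<close> a tuple that violates the relation there, and
  elementarity of \<open>\<theta>\<close> preserves realization of \<open>q\<close>.\<close>

lemma pattern_hom_pattern_rel:
  assumes f: "pattern_hom L \<pi> M N f"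
    and \<phi>s: "set \<phi>s \<subseteq> formulas L (UNIV <+> {..<m})" and q: "q \<subseteq> formulas L {..<m}"
    and ps: "length ps = length \<phi>s" "set ps \<subseteq> S_X L \<pi> M"
    and rel: "pattern_rel M m \<phi>s q ps"
  shows "pattern_rel N m \<phi>s q (map f ps)"
  unfolding pattern_rel_def
proof
  assume "\<exists>b. length b = m \<and> (\<forall>\<psi>\<in>q. sat N (nth b) [] \<psi>) \<and>
            (\<forall>i<length \<phi>s. inst b (\<phi>s ! i) \<in> map f ps ! i)"
  then obtain b where b: "length b = m" "\<And>\<psi>. \<psi> \<in> q \<Longrightarrow> sat N (nth b) [] \<psi>"
    "\<And>i. i < length \<phi>s \<Longrightarrow> inst b (\<phi>s ! i) \<in> map f ps ! i" by blast
  let ?K = "(\<lambda>i. (ps ! i, inst b (\<phi>s ! i))) ` {..<length \<phi>s}"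
  obtain \<theta> where \<theta>: "same_type L N id M \<theta> (set b)"
      "\<And>p \<phi>. (p, \<phi>) \<in> ?K \<Longrightarrow> rename (map_sum id \<theta>) \<phi> \<in> p"
  proof (rule pattern_homD[OF f, of "set b" ?K])
    have "inst b \<phi> \<in> formulas L (UNIV <+> set b)" if "\<phi> \<in> set \<phi>s" for \<phi>
      unfolding inst_def using \<phi>s that b(1) by (intro rename_in_formulas[of \<phi> L "UNIV <+> {..<m}"]) auto
    then show "?K \<subseteq> S_X L \<pi> M \<times> formulas L (UNIV <+> set b)"
      using ps by auto
    show "\<phi> \<in> f p" if "(p, \<phi>) \<in> ?K" for p \<phi> using that b(3) ps(1) by auto
  qed auto
  have "same_type L N (id \<circ> nth b) M (\<theta> \<circ> nth b) {..<m}"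
    using b(1) by (intro same_type_comp[OF \<theta>(1)]) auto
  then have st: "same_type L N (nth b) M (nth (map \<theta> b)) {..<m}"
    using b(1) by (subst (asm) same_type_cong[of _ _ "nth b" _ "nth (map \<theta> b)"]) auto
  have "sat M (nth (map \<theta> b)) [] \<psi>" if "\<psi> \<in> q" for \<psi>
    using same_typeD[OF st] b(2) q that by blast
  moreover have "inst (map \<theta> b) (\<phi>s ! i) \<in> ps ! i" if "i < length \<phi>s" for i
  proof -
    have "\<phi>s ! i \<in> formulas L (UNIV <+> {..<m})" using \<phi>s that by auto
    \<comment> \<open>The lists \<open>map \<theta> b\<close> and \<open>b\<close> are related by
      \<open>\<theta>\<close> only at positions below \<open>m\<close>; the bound on the free
      variables of the formula excludes all other positions.\<close>
    then have "inst (map \<theta> b) (\<phi>s ! i) = rename (map_sum id \<theta>) (inst b (\<phi>s ! i))"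
      unfolding inst_def fm.map_comp using b(1)
      by (intro fm.map_cong refl) (auto simp: formulas_def)
    then show ?thesis using \<theta>(2) that by simp
  qed
  ultimately have "\<not> pattern_rel M m \<phi>s q ps"
    unfolding pattern_rel_def not_not using b(1) by (intro exI[of _ "map \<theta> b"]) simp
  then show False using rel ..
qed

lemma types0_formulas:
  fixes M :: "('f, 'r, 'a) struct"
  assumes "q \<in> types0 L M m"
  shows "q \<subseteq> formulas L {..<m}"
proof
  fix \<psi> assume "\<psi> \<in> q"
  then have "rename Inl \<psi> \<in> formulas L ({..<m} <+> ({} :: 'a set))"
    using assms complete_typesD(1) unfolding types0_def by blast
  moreover have "Inl -` ({..<m} <+> ({} :: 'a set)) = {..<m}" by auto
  ultimately show "\<psi> \<in> formulas L {..<m}" by (simp add: rename_in_formulas_iff)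
qed

section \<open>Existence of homomorphisms\<close>

text \<open>The finite sets, directed by inclusion, make \<open>F\<close> a net in a product of
  two-point discrete spaces. This product is compact by Tychonoff, and \<open>g\<close> is a cluster
  point of the net; a basic neighbourhood of \<open>g\<close> fixes its values on a finite set
  \<open>J\<close>.\<close>

lemma finite_selection:
  fixes F :: "'i set \<Rightarrow> 'j \<Rightarrow> bool"
  shows "\<exists>g. \<forall>A J. finite A \<and> finite J \<longrightarrow> (\<exists>B. finite B \<and> A \<subseteq> B \<and> (\<forall>j\<in>J. F B j = g j))"
proof -
  define X where "X = product_topology (\<lambda>_ :: 'j. discrete_topology (UNIV :: bool set)) UNIV"
  have X: "compact_space X" "topspace X = UNIV"
    unfolding X_def by (simp_all add: compact_space_product_topology compact_space_discrete_topology)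
  define D where "D A = X closure_of (F ` {B. finite B \<and> A \<subseteq> B})" for A
  have "\<Inter>(D ` Collect finite) \<noteq> {}"
  proof (rule X(1)[unfolded compact_space_fip, rule_format], intro conjI ballI allI impI)
    show "closedin X C" if "C \<in> D ` Collect finite" for C using that by (auto simp: D_def)
    fix \<F> assume "finite \<F> \<and> \<F> \<subseteq> D ` Collect finite"
    then obtain \<A> where \<A>: "finite \<A>" "\<A> \<subseteq> Collect finite" "\<F> = D ` \<A>"
      by (metis finite_subset_image)
    \<comment> \<open>The union of finitely many finite index sets lies above each of them, so one
      term of the net lies in all the chosen tails.\<close>
    have "F (\<Union>\<A>) \<in> D A" if "A \<in> \<A>" for A
      unfolding D_def using \<A> that
      by (intro subsetD[OF closure_of_subset] imageI) (auto simp: X(2))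
    then show "\<Inter>\<F> \<noteq> {}" using \<A>(3) by auto
  qed
  then obtain g where g: "\<And>A. finite A \<Longrightarrow> g \<in> D A" by auto
  show ?thesis
  proof (intro exI[of _ g] allI impI)
    fix A :: "'i set" and J :: "'j set" assume "finite A \<and> finite J"
    then have fin: "finite A" "finite J" by auto
    let ?U = "\<lambda>j. if j \<in> J then {g j} else UNIV"
    have "openin X (Pi\<^sub>E UNIV ?U)"
      unfolding X_def
      by (rule product_topology_basis) (auto intro: finite_subset[OF _ fin(2)])
    moreover have "g \<in> Pi\<^sub>E UNIV ?U" by auto
    ultimately obtain h where h: "h \<in> F ` {B. finite B \<and> A \<subseteq> B}" "h \<in> Pi\<^sub>E UNIV ?U"
      using g[OF fin(1)] unfolding D_def in_closure_of by blast
    then have "h j = g j" if "j \<in> J" for j using that PiE_mem[OF h(2), of j] by simp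
    then show "\<exists>B. finite B \<and> A \<subseteq> B \<and> (\<forall>j\<in>J. F B j = g j)" using h(1) by auto
  qed
qed

lemma finite_parameters:
  assumes "finite F"
  obtains B where "finite B" "\<And>\<phi>. \<phi> \<in> F \<Longrightarrow> fv \<phi> \<subseteq> UNIV <+> B"
proof
  let ?B = "\<Union>\<phi>\<in>F. Inr -` fv \<phi>"
  show "finite ?B" using assms by (auto intro!: finite_vimageI simp: finite_fv)
  show "fv \<phi> \<subseteq> UNIV <+> ?B" if "\<phi> \<in> F" for \<phi>
  proof
    fix v assume v: "v \<in> fv \<phi>"
    show "v \<in> UNIV <+> ?B"
    proof (cases v)
      case (Inr c)
      then have "c \<in> ?B" using v that by blast
      then show ?thesis using Inr by blast
    qed auto
  qed
qed

lemma rename_Inl_cancel: "rename (map_sum id \<theta>) (rename Inl \<psi>) = rename Inl \<psi>"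
  by (simp add: fm.map_comp comp_def)

text \<open>
  Each finite set \<open>A\<close> of parameters is moved into \<open>C\<close> by a type preserving map \<open>\<theta> A\<close>; pulling \<open>p\<close>
  back along these maps and passing to a cluster point gives the image of \<open>p\<close>.
\<close>

lemma pattern_hom_exists:
  fixes C :: "('f, 'r, 'a) struct" and D :: "('f, 'r, 'b) struct"
    and \<pi> :: "('f, 'r, 'x) fm set" and T :: "('f, 'r, nat) fm set"
  assumes T: "complete_theory L T" "models C T" "models D T" and sat: "aleph0_saturated L C"
    and \<pi>: "\<pi> \<subseteq> formulas L UNIV"
  shows "\<exists>f. pattern_hom L \<pi> C D f"
proof -
  obtain \<theta> where \<theta>: "\<And>A. finite A \<Longrightarrow> same_type L D id C (\<theta> A) A"
    using same_type_realized[OF T sat] by metis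
  \<comment> \<open>The limit is taken jointly over pairs of a type and a formula. Separate limits
    for each \<open>p\<close> could follow different maps \<open>\<theta> A\<close> and would lose
    the relations between several types.\<close>
  define F :: "'b set \<Rightarrow> ('f, 'r, 'x + 'a) fm set \<times> ('f, 'r, 'x + 'b) fm \<Rightarrow> bool"
    where "F A = (\<lambda>(p, \<phi>). rename (map_sum id (\<theta> A)) \<phi> \<in> p)" for A
  have F: "F A (p, \<phi>) \<longleftrightarrow> rename (map_sum id (\<theta> A)) \<phi> \<in> p" for A p \<phi> by (simp add: F_def)
  from finite_selection[of F] obtain g
    where "\<forall>A J. finite A \<and> finite J \<longrightarrow> (\<exists>B. finite B \<and> A \<subseteq> B \<and> (\<forall>j\<in>J. F B j = g j))" ..
  then have g: "\<exists>B. finite B \<and> A \<subseteq> B \<and> (\<forall>j\<in>J. F B j = g j)" if "finite A" "finite J" for A J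
    using that by simp
  define f where "f p = {\<phi> \<in> formulas L UNIV. g (p, \<phi>)}" for p
  have "pattern_hom L \<pi> C D f"
  proof (rule pattern_homI)
    fix p assume p: "p \<in> S_X L \<pi> C"
    note pc = S_X_complete_types[OF p]
    have "f p \<in> complete_types L D UNIV UNIV"
      unfolding complete_types_def
    proof (intro CollectI conjI allI impI ballI)
      fix G assume G: "G \<subseteq> f p" "finite G"
      obtain B where B: "finite B" "\<And>\<phi>. \<phi> \<in> G \<Longrightarrow> fv \<phi> \<subseteq> UNIV <+> B"
        using finite_parameters[OF G(2)] by blast
      \<comment> \<open>One \<open>A\<close> contains all parameters of \<open>G\<close> and agrees
        with the limit on \<open>G\<close>, so \<open>G\<close> is pulled back from \<open>p\<close>
        along the single map \<open>\<theta> A\<close>.\<close>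
      obtain A where A: "finite A" "B \<subseteq> A" "\<And>\<phi>. \<phi> \<in> G \<Longrightarrow> F A (p, \<phi>) = g (p, \<phi>)"
        using g[OF B(1), of "Pair p ` G"] G(2) by auto
      let ?G = "rename (map_sum id (\<theta> A)) ` G"
      have "?G \<subseteq> p" using G(1) A(3) F by (auto simp: f_def)
      then obtain e where e: "realizes C e ?G" using complete_typesD(2)[OF pc] G(2) by blast
      have e': "sat C (case_sum e (\<theta> A)) [] \<phi>" if "\<phi> \<in> G" for \<phi>
      proof -
        have "sat C (case_sum e id \<circ> map_sum id (\<theta> A)) [] \<phi>"
          using e that by (simp add: realizes_def sat_rename)
        moreover have "case_sum e id \<circ> map_sum id (\<theta> A) = case_sum e (\<theta> A)"
          by (rule ext) (simp split: sum.split)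
        ultimately show ?thesis by simp
      qed
      \<comment> \<open>In \<open>C\<close> the set \<open>G\<close> is satisfied with each
        parameter \<open>a\<close> read as \<open>\<theta> A a\<close>. Transfer in the opposite
        direction yields a solution in \<open>D\<close> that reads \<open>a\<close> as
        itself.\<close>
      have "same_type L D (id \<circ> case_sum undefined id) C (\<theta> A \<circ> case_sum undefined id)
          (Inr ` A :: ('x + 'b) set)"
        by (rule same_type_comp[OF \<theta>[OF A(1)]]) auto
      then have "same_type L C (\<theta> A \<circ> case_sum undefined id) D (id \<circ> case_sum undefined id)
          (Inr ` A :: ('x + 'b) set)"
        by (rule same_type_sym)
      moreover have "G \<subseteq> formulas L UNIV" using G(1) by (auto simp: f_def)
      moreover have "case_sum e (\<theta> A) v = (\<theta> A \<circ> case_sum undefined id) v" if "v \<in> Inr ` A" for v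
        using that by auto
      ultimately obtain d where d: "\<And>v. v \<in> Inr ` A \<Longrightarrow> d v = (id \<circ> case_sum undefined id) v"
          "\<And>\<phi>. \<phi> \<in> G \<Longrightarrow> sat D d [] \<phi>"
        using same_type_transfer[OF _ G(2) _ _ e'] by blast
      have "sat D (case_sum (d \<circ> Inl) id) [] \<phi>" if "\<phi> \<in> G" for \<phi>
      proof -
        have "case_sum (d \<circ> Inl) id v = d v" if "v \<in> fv \<phi>" for v
        proof -
          have "v \<in> UNIV <+> A" using that \<open>\<phi> \<in> G\<close> B(2) A(2) by blast
          then show ?thesis using d(1)[of v] by auto
        qed
        then show ?thesis using d(2)[OF \<open>\<phi> \<in> G\<close>] sat_cong by metis
      qed
      then show "\<exists>e. realizes D e G" by (auto simp: realizes_def)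
    next
      fix \<phi> :: "('f, 'r, 'x + 'b) fm" assume "\<phi> \<in> formulas L (UNIV <+> UNIV)"
      then have \<phi>: "\<phi> \<in> formulas L UNIV" by simp
      \<comment> \<open>Both formulas must be decided at the same index \<open>A\<close>, since
        completeness of \<open>p\<close> speaks about one pullback at a time.\<close>
      obtain A where "F A (p, \<phi>) = g (p, \<phi>)" "F A (p, Neg \<phi>) = g (p, Neg \<phi>)"
        using g[of "{}" "{(p, \<phi>), (p, Neg \<phi>)}"] by auto
      moreover have "rename (map_sum id (\<theta> A)) \<phi> \<in> formulas L (UNIV <+> UNIV)"
        by (rule rename_in_formulas[OF \<phi>]) simp
      ultimately show "\<phi> \<in> f p \<or> Neg \<phi> \<in> f p"
        using complete_typesD(3)[OF pc] \<phi> by (auto simp: f_def F)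
    qed (auto simp: f_def)
    moreover have "rename Inl \<psi> \<in> f p" if "\<psi> \<in> \<pi>" for \<psi>
    proof -
      obtain A where "F A (p, rename Inl \<psi>) = g (p, rename Inl \<psi>)"
        using g[of "{}" "{(p, rename Inl \<psi>)}"] by auto
      then show ?thesis using p \<pi> that
        by (auto simp: f_def F rename_Inl_cancel S_X_def intro: rename_in_formulas)
    qed
    ultimately show "f p \<in> S_X L \<pi> D" by (auto simp: S_X_def)
  next
    fix B :: "'b set" and K assume B: "finite B" and K: "finite K"
      and mem: "\<And>p \<phi>. (p, \<phi>) \<in> K \<Longrightarrow> \<phi> \<in> f p"
    obtain A where A: "finite A" "B \<subseteq> A" "\<forall>j\<in>K. F A j = g j" using g[OF B K] by blast
    have "same_type L D id C (\<theta> A) B" using \<theta>[OF A(1)] A(2) by (rule same_type_mono)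
    moreover have "rename (map_sum id (\<theta> A)) \<phi> \<in> p" if "(p, \<phi>) \<in> K" for p \<phi>
      using mem[OF that] A(3) that F by (auto simp: f_def)
    ultimately show "\<exists>\<theta>. same_type L D id C \<theta> B \<and> (\<forall>(p, \<phi>)\<in>K. rename (map_sum id \<theta>) \<phi> \<in> p)"
      by blast
  qed
  then show ?thesis by blast
qed

section \<open>The Ellis semigroup as the endomorphism semigroup\<close>

lemma val_automorphism:
  assumes "\<sigma> \<in> automorphisms L M"
  shows "wf_tm L (length bs) t \<Longrightarrow> val M (\<lambda>v. \<sigma> (e v)) (map \<sigma> bs) t = \<sigma> (val M e bs t)"
proof (induction t)
  case (Fun f ts)
  then have "map (val M (\<lambda>v. \<sigma> (e v)) (map \<sigma> bs)) ts = map \<sigma> (map (val M e bs) ts)"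
    unfolding map_map by (intro map_cong) auto
  then show ?case using assms Fun.prems by (simp add: automorphisms_def del: map_map)
qed auto

lemma sat_automorphism:
  assumes "\<sigma> \<in> automorphisms L M"
  shows "wf_fm L (length bs) \<phi> \<Longrightarrow> sat M (\<lambda>v. \<sigma> (e v)) (map \<sigma> bs) \<phi> \<longleftrightarrow> sat M e bs \<phi>"
proof (induction \<phi> arbitrary: bs)
  case (Eq s t)
  have "inj \<sigma>" using assms by (simp add: automorphisms_def bij_def)
  then show ?case using Eq by (simp add: val_automorphism[OF assms] inj_eq)
next
  case (Rel r ts)
  then have "map (val M (\<lambda>v. \<sigma> (e v)) (map \<sigma> bs)) ts = map \<sigma> (map (val M e bs) ts)"
    unfolding map_map by (intro map_cong) (auto simp: val_automorphism[OF assms])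
  then show ?case using assms Rel.prems by (simp add: automorphisms_def del: map_map)
next
  case (All \<phi>)
  have "surj \<sigma>" using assms by (simp add: automorphisms_def bij_def)
  moreover have "sat M (\<lambda>v. \<sigma> (e v)) (\<sigma> a # map \<sigma> bs) \<phi> \<longleftrightarrow> sat M e (a # bs) \<phi>" for a
    using All.IH[of "a # bs"] All.prems by simp
  ultimately show ?case by (metis sat.simps(5) surjD)
qed auto

lemma same_type_automorphism:
  assumes "\<sigma> \<in> automorphisms L M"
  shows "same_type L M e M (\<sigma> \<circ> e) W"
  unfolding same_type_def comp_def
proof
  fix \<phi> assume "\<phi> \<in> formulas L W"
  then show "sat M e [] \<phi> \<longleftrightarrow> sat M (\<lambda>v. \<sigma> (e v)) [] \<phi>"
    using sat_automorphism[OF assms, of "[]" \<phi> e] by (simp add: formulas_def)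
qed

lemma act_in_S_X:
  fixes M :: "('f, 'r, 'a) struct" and \<pi> :: "('f, 'r, 'x) fm set"
  assumes \<sigma>: "\<sigma> \<in> automorphisms L M" and p: "p \<in> S_X L \<pi> M"
  shows "act \<sigma> p \<in> S_X L \<pi> M"
proof -
  note pc = S_X_complete_types[OF p]
  have bij: "bij \<sigma>" using \<sigma> by (simp add: automorphisms_def)
  have "act \<sigma> p \<in> complete_types L M UNIV UNIV"
    unfolding complete_types_def
  proof (intro CollectI conjI allI impI ballI)
    show "act \<sigma> p \<subseteq> formulas L (UNIV <+> UNIV)"
      using complete_typesD(1)[OF pc] by (auto simp: act_def intro: rename_in_formulas)
  next
    fix F assume "F \<subseteq> act \<sigma> p" "finite F"
    then obtain G where G: "G \<subseteq> p" "finite G" "F = rename (map_sum id \<sigma>) ` G"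
      unfolding act_def by (metis finite_subset_image)
    then obtain e where e: "realizes M e G" using complete_typesD(2)[OF pc] by blast
    have "sat M (case_sum (\<sigma> \<circ> e) id) [] (rename (map_sum id \<sigma>) \<phi>)" if "\<phi> \<in> G" for \<phi>
    proof -
      have "case_sum (\<sigma> \<circ> e) id \<circ> map_sum id \<sigma> = \<sigma> \<circ> case_sum e id"
        by (rule ext) (simp split: sum.split)
      moreover have "\<phi> \<in> formulas L UNIV" using that G(1) complete_typesD(1)[OF pc] by auto
      ultimately show ?thesis
        using e that same_typeD[OF same_type_automorphism[OF \<sigma>], of \<phi> UNIV "case_sum e id"]
        by (simp add: sat_rename realizes_def)
    qed
    then show "\<exists>e. realizes M e F" unfolding G(3) realizes_def by blast
  next
    fix \<phi> :: "('f, 'r, 'x + 'a) fm" assume \<phi>: "\<phi> \<in> formulas L (UNIV <+> UNIV)"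
    let ?\<psi> = "rename (map_sum id (inv \<sigma>)) \<phi>"
    have "?\<psi> \<in> formulas L (UNIV <+> UNIV)" by (rule rename_in_formulas[OF \<phi>]) simp
    then have "?\<psi> \<in> p \<or> Neg ?\<psi> \<in> p" using complete_typesD(3)[OF pc] by blast
    moreover have "\<sigma> \<circ> inv \<sigma> = id" using bij by (simp add: bij_is_surj surj_iff[symmetric])
    then have "\<phi> = rename (map_sum id \<sigma>) ?\<psi>"
      by (simp add: rename_map_sum_comp map_sum.id fm.map_id del: o_apply)
    ultimately show "\<phi> \<in> act \<sigma> p \<or> Neg \<phi> \<in> act \<sigma> p" unfolding act_def by (metis imageI rename_Neg)
  qed
  moreover have "rename Inl \<psi> \<in> act \<sigma> p" if "\<psi> \<in> \<pi>" for \<psi>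
  proof -
    have "rename (map_sum id \<sigma>) (rename Inl \<psi>) \<in> act \<sigma> p"
      unfolding act_def using p that by (intro imageI) (auto simp: S_X_def)
    then show ?thesis by (simp only: rename_Inl_cancel)
  qed
  ultimately show ?thesis by (auto simp: S_X_def)
qed

section \<open>Basic open sets of the type space and of its space of self-maps\<close>

lemma openin_type_topology:
  "\<phi> \<in> formulas L UNIV \<Longrightarrow> openin (type_topology L \<pi> M) {p \<in> S_X L \<pi> M. \<phi> \<in> p}"
  unfolding type_topology_def by (rule topology_generated_by_Basis) auto

lemma topspace_type_topology [simp]: "topspace (type_topology L \<pi> M) = S_X L \<pi> M"
proof -
  have "\<exists>\<phi>\<in>formulas L UNIV. \<phi> \<in> p" if "p \<in> S_X L \<pi> M" for p
    using complete_typesD(1)[OF S_X_complete_types[OF that]]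
      complete_typesD(3)[OF S_X_complete_types[OF that], of Bot] by (force simp: formulas_def)
  then show ?thesis unfolding type_topology_def by auto
qed

text \<open>The generating sets are a priori only a subbase. Complete types respect conjunction, so
  the family is closed under binary intersections and each neighbourhood of \<open>p\<close> is
  witnessed by a single formula.\<close>

lemma type_topology_base:
  assumes "openin (type_topology L \<pi> M) U" "p \<in> U"
  shows "\<exists>\<phi>\<in>formulas L UNIV. \<phi> \<in> p \<and> {r \<in> S_X L \<pi> M. \<phi> \<in> r} \<subseteq> U"
proof -
  have "generate_topology_on ((\<lambda>\<phi>. {p \<in> S_X L \<pi> M. \<phi> \<in> p}) ` formulas L UNIV) U"
    using assms(1) by (simp add: type_topology_def openin_topology_generated_by_iff)
  then show ?thesis
    using assms(2)
  proof induction
    case (Int a b)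
    obtain \<phi> where \<phi>: "\<phi> \<in> formulas L UNIV" "\<phi> \<in> p" "{r \<in> S_X L \<pi> M. \<phi> \<in> r} \<subseteq> a"
      using Int by blast
    obtain \<psi> where \<psi>: "\<psi> \<in> formulas L UNIV" "\<psi> \<in> p" "{r \<in> S_X L \<pi> M. \<psi> \<in> r} \<subseteq> b"
      using Int by blast
    have "openin (type_topology L \<pi> M) a"
      using Int.hyps(1) by (simp add: type_topology_def openin_topology_generated_by_iff)
    from openin_subset[OF this] have "p \<in> S_X L \<pi> M" using Int.prems by auto
    moreover have conj: "Conj \<phi> \<psi> \<in> r \<longleftrightarrow> \<phi> \<in> r \<and> \<psi> \<in> r" if "r \<in> S_X L \<pi> M" for r
      using Conj_in_complete_type[OF S_X_complete_types[OF that]] \<phi>(1) \<psi>(1) by simp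
    ultimately have "Conj \<phi> \<psi> \<in> p" using \<phi>(2) \<psi>(2) by blast
    moreover have "{r \<in> S_X L \<pi> M. Conj \<phi> \<psi> \<in> r} \<subseteq> a \<inter> b" using conj \<phi>(3) \<psi>(3) by auto
    ultimately show ?case using \<phi>(1) \<psi>(1) by (intro bexI[of _ "Conj \<phi> \<psi>"]) auto
  next
    case (UN K)
    then show ?case by (meson Union_iff Union_upper order_trans)
  qed auto
qed

lemma openin_product_type_topology:
  assumes "finite K" "K \<subseteq> S_X L \<pi> M \<times> formulas L UNIV"
  shows "openin (product_topology (\<lambda>_. type_topology L \<pi> M) (S_X L \<pi> M))
    {\<eta> \<in> S_X L \<pi> M \<rightarrow>\<^sub>E S_X L \<pi> M. \<forall>(p, \<phi>)\<in>K. \<phi> \<in> \<eta> p}" (is "openin ?X _")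
  using assms
proof (induction K)
  case empty
  then show ?case using openin_topspace[of ?X] by simp
next
  case (insert x K)
  obtain p \<phi> where x: "x = (p, \<phi>)" "p \<in> S_X L \<pi> M" "\<phi> \<in> formulas L UNIV" using insert.prems by auto
  have "openin ?X {\<eta> \<in> topspace ?X. \<eta> p \<in> {r \<in> S_X L \<pi> M. \<phi> \<in> r}}"
    using x by (intro openin_continuous_map_preimage[OF continuous_map_product_projection]
        openin_type_topology) auto
  then have "openin ?X ({\<eta> \<in> topspace ?X. \<eta> p \<in> {r \<in> S_X L \<pi> M. \<phi> \<in> r}} \<inter>
      {\<eta> \<in> S_X L \<pi> M \<rightarrow>\<^sub>E S_X L \<pi> M. \<forall>(p, \<phi>)\<in>K. \<phi> \<in> \<eta> p})"
    using insert by blast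
  also have "{\<eta> \<in> topspace ?X. \<eta> p \<in> {r \<in> S_X L \<pi> M. \<phi> \<in> r}} \<inter>
      {\<eta> \<in> S_X L \<pi> M \<rightarrow>\<^sub>E S_X L \<pi> M. \<forall>(p, \<phi>)\<in>K. \<phi> \<in> \<eta> p} =
      {\<eta> \<in> S_X L \<pi> M \<rightarrow>\<^sub>E S_X L \<pi> M. \<forall>(p, \<phi>)\<in>insert x K. \<phi> \<in> \<eta> p}"
    using x by auto
  finally show ?case .
qed

text \<open>A basic neighbourhood of \<open>\<eta>\<close> is a finite list of demands that formulas
  belong to values of \<open>\<eta>\<close>. An automorphism meets them iff its inverse moves each
  formula into the corresponding type. So approximation by automorphisms yields the partial
  elementary maps of a homomorphism, and strong homogeneity extends such maps to
  automorphisms.\<close>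

lemma ellis_eq_pattern_hom:
  assumes hom: "strongly_aleph0_homogeneous L M"
  shows "ellis L \<pi> M = {\<eta> \<in> S_X L \<pi> M \<rightarrow>\<^sub>E S_X L \<pi> M. pattern_hom L \<pi> M M \<eta>}" (is "_ = ?E")
proof
  let ?S = "S_X L \<pi> M"
  let ?X = "product_topology (\<lambda>_. type_topology L \<pi> M) ?S"
  show "ellis L \<pi> M \<subseteq> ?E"
  proof
    fix \<eta> assume "\<eta> \<in> ellis L \<pi> M"
    then have \<eta>: "\<eta> \<in> ?S \<rightarrow>\<^sub>E ?S"
      and cl: "\<And>U. openin ?X U \<Longrightarrow> \<eta> \<in> U \<Longrightarrow> \<exists>\<sigma>\<in>automorphisms L M. restrict (act \<sigma>) ?S \<in> U"
      unfolding ellis_def in_closure_of by auto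
    have "pattern_hom L \<pi> M M \<eta>"
    proof (rule pattern_homI)
      show "\<eta> p \<in> ?S" if "p \<in> ?S" for p using \<eta> that by auto
      fix B K assume K: "finite K" "K \<subseteq> ?S \<times> formulas L (UNIV <+> B)"
        and mem: "\<And>p \<phi>. (p, \<phi>) \<in> K \<Longrightarrow> \<phi> \<in> \<eta> p"
      have "K \<subseteq> ?S \<times> formulas L UNIV" using K(2) formulas_mono[OF subset_UNIV] by blast
      from cl[OF openin_product_type_topology[OF K(1) this]]
      obtain \<sigma> where \<sigma>: "\<sigma> \<in> automorphisms L M" "\<And>p \<phi>. (p, \<phi>) \<in> K \<Longrightarrow> \<phi> \<in> restrict (act \<sigma>) ?S p"
        using \<eta> mem by blast
      have bij: "bij \<sigma>" using \<sigma>(1) by (simp add: automorphisms_def)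
      \<comment> \<open>The action moves parameters forward, so the map sending formulas of
        \<open>\<eta> p\<close> back into \<open>p\<close> is \<open>inv \<sigma>\<close>.\<close>
      have "same_type L M (inv \<sigma>) M (\<sigma> \<circ> inv \<sigma>) B" by (rule same_type_automorphism[OF \<sigma>(1)])
      moreover have "\<sigma> \<circ> inv \<sigma> = id" using bij by (simp add: bij_is_surj surj_iff[symmetric])
      ultimately have "same_type L M id M (inv \<sigma>) B" using same_type_sym by metis
      moreover have "rename (map_sum id (inv \<sigma>)) \<phi> \<in> p" if "(p, \<phi>) \<in> K" for p \<phi>
      proof -
        have "\<phi> \<in> act \<sigma> p" using \<sigma>(2)[OF that] K(2) that by auto
        then obtain \<psi> where \<psi>: "\<psi> \<in> p" "\<phi> = rename (map_sum id \<sigma>) \<psi>" by (auto simp: act_def)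
        have "inv \<sigma> \<circ> \<sigma> = id" using bij by (simp add: bij_is_inj)
        then have "rename (map_sum id (inv \<sigma>)) \<phi> = \<psi>"
          unfolding \<psi>(2) rename_map_sum_comp by (simp add: map_sum.id fm.map_id)
        then show ?thesis using \<psi>(1) by simp
      qed
      ultimately show "\<exists>\<theta>. same_type L M id M \<theta> B \<and> (\<forall>(p, \<phi>)\<in>K. rename (map_sum id \<theta>) \<phi> \<in> p)"
        by blast
    qed
    then show "\<eta> \<in> ?E" using \<eta> by simp
  qed
  show "?E \<subseteq> ellis L \<pi> M"
  proof
    fix \<eta> assume "\<eta> \<in> ?E"
    then have \<eta>: "\<eta> \<in> ?S \<rightarrow>\<^sub>E ?S" and h: "pattern_hom L \<pi> M M \<eta>" by auto
    have "\<exists>y. y \<in> (\<lambda>\<sigma>. restrict (act \<sigma>) ?S) ` automorphisms L M \<and> y \<in> U"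
      if U: "\<eta> \<in> U" "openin ?X U" for U
    proof -
      obtain V where V: "finite {p \<in> ?S. V p \<noteq> topspace (type_topology L \<pi> M)}"
          "\<And>p. p \<in> ?S \<Longrightarrow> openin (type_topology L \<pi> M) (V p)" "\<eta> \<in> Pi\<^sub>E ?S V" "Pi\<^sub>E ?S V \<subseteq> U"
        using U unfolding openin_product_topology_alt by meson
      define P where "P = {p \<in> ?S. V p \<noteq> ?S}"
      have P: "finite P" using V(1) by (simp add: P_def)
      have "\<forall>p\<in>P. \<exists>\<phi>. \<phi> \<in> formulas L UNIV \<and> \<phi> \<in> \<eta> p \<and> {r \<in> ?S. \<phi> \<in> r} \<subseteq> V p"
        using V(2,3) unfolding Bex_def[symmetric]
        by (intro ballI type_topology_base) (auto simp: P_def)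
      from bchoice[OF this] obtain \<phi> where \<phi>: "\<And>p. p \<in> P \<Longrightarrow> \<phi> p \<in> formulas L UNIV" "\<And>p. p \<in> P \<Longrightarrow> \<phi> p \<in> \<eta> p"
          "\<And>p. p \<in> P \<Longrightarrow> {r \<in> ?S. \<phi> p \<in> r} \<subseteq> V p"
        by blast
      obtain B where B: "finite B" "\<And>\<psi>. \<psi> \<in> \<phi> ` P \<Longrightarrow> fv \<psi> \<subseteq> UNIV <+> B"
        using finite_parameters[OF finite_imageI[OF P]] by blast
      obtain \<theta> where \<theta>: "same_type L M id M \<theta> B"
        "\<And>p \<psi>. (p, \<psi>) \<in> (\<lambda>p. (p, \<phi> p)) ` P \<Longrightarrow> rename (map_sum id \<theta>) \<psi> \<in> p"
      proof (rule pattern_homD[OF h B(1), of "(\<lambda>p. (p, \<phi> p)) ` P"])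
        show "(\<lambda>p. (p, \<phi> p)) ` P \<subseteq> ?S \<times> formulas L (UNIV <+> B)"
          using \<phi>(1) B(2) by (auto simp: P_def formulas_def)
      qed (use P \<phi>(2) in auto)
      obtain b where b: "set b = B" using finite_list[OF B(1)] by blast
      have "same_type L M (id \<circ> nth b) M (\<theta> \<circ> nth b) {..<length b}"
        using b by (intro same_type_comp[OF \<theta>(1)]) auto
      then have "same_type L M (nth b) M (nth (map \<theta> b)) {..<length b}"
        by (subst (asm) same_type_cong[of _ _ "nth b" _ "nth (map \<theta> b)"]) auto
      \<comment> \<open>Homogeneity is applied from \<open>map \<theta> b\<close> to
        \<open>b\<close>, so that \<open>\<sigma>\<close> extends the inverse of
        \<open>\<theta>\<close> on \<open>B\<close> and \<open>act \<sigma>\<close> undoes the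
        renaming by \<open>\<theta>\<close>.\<close>
      then have "tp L M (map \<theta> b) = tp L M b" using same_type_tp[of b "map \<theta> b" L M M] by simp
      then obtain \<sigma> where \<sigma>: "\<sigma> \<in> automorphisms L M" "map \<sigma> (map \<theta> b) = b"
        using hom unfolding strongly_aleph0_homogeneous_def by (metis length_map)
      have \<sigma>\<theta>: "\<sigma> (\<theta> c) = c" if "c \<in> B" for c
        using \<sigma>(2) that map_eq_conv[of "\<sigma> \<circ> \<theta>" b id] by (simp add: b)
      have "restrict (act \<sigma>) ?S \<in> Pi\<^sub>E ?S V"
      proof (rule restrict_PiE_iff[THEN iffD2], rule ballI)
        fix p assume p: "p \<in> ?S"
        show "act \<sigma> p \<in> V p"
        proof (cases "p \<in> P")
          case True
          have "rename (map_sum id \<sigma>) (rename (map_sum id \<theta>) (\<phi> p)) = rename id (\<phi> p)"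
            unfolding rename_map_sum_comp
          proof (rule fm.map_cong[OF refl])
            fix v assume "v \<in> fv (\<phi> p)"
            then have "v \<in> UNIV <+> B" using B(2)[of "\<phi> p"] True by blast
            then show "map_sum id (\<sigma> \<circ> \<theta>) v = id v" using \<sigma>\<theta> by auto
          qed
          moreover have "rename (map_sum id \<theta>) (\<phi> p) \<in> p" using \<theta>(2) True by blast
          ultimately have "\<phi> p \<in> act \<sigma> p" unfolding act_def by (metis fm.map_id imageI)
          then show ?thesis using \<phi>(3)[OF True] act_in_S_X[OF \<sigma>(1) p] by blast
        next
          case False
          then show ?thesis using act_in_S_X[OF \<sigma>(1) p] p by (simp add: P_def)
        qed
      qed
      then show ?thesis using \<sigma>(1) V(4) by blast
    qed
    then show "\<eta> \<in> ellis L \<pi> M" unfolding ellis_def in_closure_of using \<eta> by auto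
  qed
qed

section \<open>Minimal left ideals\<close>

text \<open>For \<open>x\<close> in \<open>I\<close> the left ideal \<open>E x\<close> lies in
  \<open>I\<close>, so it equals \<open>I\<close> by minimality and contains \<open>u\<close>. Thus
  every element of \<open>I\<close> has a left inverse with respect to \<open>u\<close>, and
  applying this twice makes the inverse of \<open>z\<close> two-sided.\<close>

lemma minimal_left_ideal_inverse:
  assumes min: "minimal_left_ideal mul E I" and u: "u \<in> I" "mul u u = u"
    and closed: "\<And>x y. x \<in> E \<Longrightarrow> y \<in> E \<Longrightarrow> mul x y \<in> E"
    and assoc: "\<And>x y z. x \<in> E \<Longrightarrow> y \<in> E \<Longrightarrow> z \<in> E \<Longrightarrow> mul (mul x y) z = mul x (mul y z)"
    and z: "z \<in> E" "mul u z = z" "mul z u = z"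
  shows "\<exists>c\<in>E. mul c z = u \<and> mul z c = u"
proof -
  have li: "I \<subseteq> E" "\<And>f g. f \<in> E \<Longrightarrow> g \<in> I \<Longrightarrow> mul f g \<in> I"
    using min by (auto simp: minimal_left_ideal_def left_ideal_def)
  have uE: "u \<in> E" using u li by auto
  have ex: "\<exists>c\<in>E. mul c x = u" if x: "x \<in> I" for x
  proof -
    let ?I = "(\<lambda>c. mul c x) ` E"
    have "mul f g \<in> ?I" if fg: "f \<in> E" "g \<in> ?I" for f g
    proof -
      obtain c where c: "c \<in> E" "g = mul c x" using fg(2) by auto
      then have "mul f g = mul (mul f c) x" using assoc[of f c x] fg(1) x li(1) by auto
      then show ?thesis using closed fg(1) c(1) by blast
    qed
    then have "left_ideal mul E ?I"
      unfolding left_ideal_def using uE closed x li(1) by blast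
    moreover have "?I \<subseteq> I" using li(2) x by auto
    ultimately have "?I = I" using min by (simp add: minimal_left_ideal_def)
    then show ?thesis using u(1) by blast
  qed
  have "z \<in> I" using li(2)[OF z(1) u(1)] z(3) by simp
  then obtain c0 where c0: "c0 \<in> E" "mul c0 z = u" using ex by blast
  \<comment> \<open>Multiplying by \<open>u\<close> on both sides makes \<open>u\<close> a left
    identity for \<open>c\<close> and puts \<open>c\<close> into \<open>I\<close>, so that
    \<open>c\<close> has a left inverse \<open>d\<close> in turn; comparing \<open>d c z\<close> in
    two ways gives \<open>z = d u\<close>.\<close>
  define c where "c = mul u (mul c0 u)"
  have c0u: "mul c0 u \<in> E" using closed c0(1) uE by blast
  have cI: "c \<in> I" and cE: "c \<in> E"
    unfolding c_def using li(2) c0(1) u(1) uE li(1) by blast+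
  have "mul c z = mul u (mul (mul c0 u) z)" unfolding c_def using assoc uE c0u z(1) by blast
  also have "mul (mul c0 u) z = u" using assoc[OF c0(1) uE z(1)] z(2) c0(2) by simp
  finally have cz: "mul c z = u" using u(2) by simp
  have uc: "mul u c = c" unfolding c_def using assoc[OF uE uE c0u] u(2) by simp
  obtain d where d: "d \<in> E" "mul d c = u" using ex[OF cI] by blast
  have "z = mul (mul d c) z" using d(2) z(2) by simp
  also have "\<dots> = mul d u" using assoc[OF d(1) cE z(1)] cz by simp
  finally have "mul z c = mul d (mul u c)" using assoc[OF d(1) uE cE] by simp
  then have "mul z c = u" using uc d(2) by simp
  then show ?thesis using cz cE by blast
qed

text \<open>An arbitrary endomorphism \<open>z\<close> becomes a member of the group of
  \<open>u\<close> once compressed to \<open>u z u\<close>. The case of interest is a round trip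
  through the other model.\<close>

lemma ellis_idempotent_inverse:
  assumes hom: "strongly_aleph0_homogeneous L M"
    and min: "minimal_left_ideal (compose (S_X L \<pi> M)) (ellis L \<pi> M) I"
    and u: "u \<in> I" "compose (S_X L \<pi> M) u u = u"
    and z: "pattern_hom L \<pi> M M z"
  obtains c where "pattern_hom L \<pi> M M c"
    "\<And>p. p \<in> S_X L \<pi> M \<Longrightarrow> c (u (z (u p))) = u p" "\<And>p. p \<in> S_X L \<pi> M \<Longrightarrow> u (z (u (c p))) = u p"
proof -
  let ?S = "S_X L \<pi> M" and ?E = "ellis L \<pi> M"
  note E = ellis_eq_pattern_hom[OF hom, of \<pi>]
  have uE: "u \<in> ?E" using min u(1) by (auto simp: minimal_left_ideal_def left_ideal_def)
  have ES: "x \<in> ?S \<rightarrow> ?S" and Eh: "pattern_hom L \<pi> M M x" if "x \<in> ?E" for x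
    using that by (auto simp: E)
  have EI: "compose ?S x y \<in> ?E" if "pattern_hom L \<pi> M M x" "pattern_hom L \<pi> M M y" for x y
    using pattern_hom_compose[OF that(2,1)] unfolding E
    by (auto simp: PiE_def pattern_hom_def)
  have assoc: "compose ?S (compose ?S x y) w = compose ?S x (compose ?S y w)"
    if "w \<in> ?S \<rightarrow> ?S" for x y w
    using compose_assoc[OF that, of x y] by simp
  define z' where "z' = compose ?S u (compose ?S z u)"
  have zu: "compose ?S z u \<in> ?E" using EI z Eh[OF uE] by blast
  have z'E: "z' \<in> ?E" unfolding z'_def using EI Eh zu uE by blast
  have uz': "compose ?S u z' = z'" unfolding z'_def using assoc[OF ES[OF zu], of u u] u(2) by simp
  have "compose ?S z' u = z'"
    unfolding z'_def assoc[OF ES[OF uE]] u(2) by simp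
  with uz' obtain c where c: "c \<in> ?E" "compose ?S c z' = u" "compose ?S z' c = u"
    using minimal_left_ideal_inverse[OF min u, of z'] EI Eh assoc ES z'E by blast
  have z': "z' p = u (z (u p))" if "p \<in> ?S" for p
    using that by (simp add: z'_def compose_def)
  show thesis
  proof (rule that)
    show "pattern_hom L \<pi> M M c" using Eh c(1) .
    fix p assume p: "p \<in> ?S"
    show "c (u (z (u p))) = u p" using fun_cong[OF c(2), of p] p by (simp add: compose_def z')
    have "c p \<in> ?S" using ES[OF c(1)] p by auto
    then show "u (z (u (c p))) = u p" using fun_cong[OF c(3), of p] p by (simp add: compose_def z')
  qed
qed

theorem theorem2p41:
  fixes L :: "('f, 'r) lang"
    and T :: "('f, 'r, nat) fm set"
    and \<pi> :: "('f, 'r, 'x) fm set"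
    and C1 :: "('f, 'r, 'a) struct"
    and C2 :: "('f, 'r, 'b) struct"
  assumes "complete_theory L T"
    and "\<pi> \<subseteq> formulas L UNIV"
    and "models C1 T" "aleph0_saturated L C1" "strongly_aleph0_homogeneous L C1"
    and "minimal_left_ideal (compose (S_X L \<pi> C1)) (ellis L \<pi> C1) M1"
    and "u1 \<in> M1" "compose (S_X L \<pi> C1) u1 u1 = u1"
    and "models C2 T" "aleph0_saturated L C2" "strongly_aleph0_homogeneous L C2"
    and "minimal_left_ideal (compose (S_X L \<pi> C2)) (ellis L \<pi> C2) M2"
    and "u2 \<in> M2" "compose (S_X L \<pi> C2) u2 u2 = u2"
  shows "\<exists>h. pattern_iso L C1 C2 (u1 ` S_X L \<pi> C1) (u2 ` S_X L \<pi> C2) h"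
proof -
  let ?S1 = "S_X L \<pi> C1" and ?S2 = "S_X L \<pi> C2"
  obtain f where f: "pattern_hom L \<pi> C1 C2 f"
    using pattern_hom_exists[OF assms(1,3,9,4,2)] by blast
  obtain g where g: "pattern_hom L \<pi> C2 C1 g"
    using pattern_hom_exists[OF assms(1,9,3,10,2)] by blast
  have "u1 \<in> ellis L \<pi> C1" "u2 \<in> ellis L \<pi> C2"
    using assms(6,7,12,13) by (auto simp: minimal_left_ideal_def left_ideal_def)
  then have u1: "pattern_hom L \<pi> C1 C1 u1" and u2: "pattern_hom L \<pi> C2 C2 u2"
    by (auto simp: ellis_eq_pattern_hom[OF assms(5)] ellis_eq_pattern_hom[OF assms(11)])
  note S = pattern_hom_in_S_X[OF f] pattern_hom_in_S_X[OF g] pattern_hom_in_S_X[OF u1]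
    pattern_hom_in_S_X[OF u2]
  obtain c where c: "pattern_hom L \<pi> C1 C1 c"
      "\<And>p. p \<in> ?S1 \<Longrightarrow> c (u1 (compose ?S1 g (compose ?S1 u2 f) (u1 p))) = u1 p"
    using ellis_idempotent_inverse[OF assms(5,6,7,8) pattern_hom_compose[OF pattern_hom_compose[OF f u2] g]]
    by metis
  have c2: "c (u1 (g (u2 (f (u1 p))))) = u1 p" if "p \<in> ?S1" for p
    using c(2)[OF that] S(3)[OF that] by (simp add: compose_def)
  \<comment> \<open>The round trip starting from \<open>C2\<close> contributes a right inverse,
    which will give surjectivity onto the image of \<open>u2\<close>.\<close>
  obtain d where d: "pattern_hom L \<pi> C2 C2 d"
      "\<And>p. p \<in> ?S2 \<Longrightarrow> u2 (compose ?S2 f (compose ?S2 u1 g) (u2 (d p))) = u2 p"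
    using ellis_idempotent_inverse[OF assms(11,12,13,14) pattern_hom_compose[OF pattern_hom_compose[OF g u1] f]]
    by metis
  have d2: "u2 (f (u1 (g (u2 (d p))))) = u2 p" if "p \<in> ?S2" for p
    using d(2)[OF that] S(4)[OF pattern_hom_in_S_X[OF d(1) that]] by (simp add: compose_def)
  define a where "a = compose ?S1 u2 f"
  \<comment> \<open>The left inverse of \<open>a\<close> on the image of \<open>u1\<close>, read off
    from \<open>c u1 g u2 f u1 = u1\<close>. It is a homomorphism on all of
    \<open>S_X L \<pi> C2\<close>.\<close>
  define b where "b = compose ?S2 c (compose ?S2 u1 g)"
  have a: "pattern_hom L \<pi> C1 C2 a" unfolding a_def using pattern_hom_compose[OF f u2] .
  have b: "pattern_hom L \<pi> C2 C1 b"
    unfolding b_def using pattern_hom_compose[OF pattern_hom_compose[OF g u1] c(1)] .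
  have a_eq: "a p = u2 (f p)" if "p \<in> ?S1" for p using that by (simp add: a_def compose_def)
  have ba: "b (a p) = p" if "p \<in> u1 ` ?S1" for p
  proof -
    obtain r where r: "r \<in> ?S1" "p = u1 r" using \<open>p \<in> u1 ` ?S1\<close> by blast
    have "p \<in> ?S1" using r S(3) by simp
    then have "b (a p) = c (u1 (g (u2 (f p))))" using S by (simp add: a_eq b_def compose_def)
    then show ?thesis using c2[OF r(1)] r(2) by simp
  qed
  have "bij_betw a (u1 ` ?S1) (u2 ` ?S2)"
    unfolding bij_betw_def
  proof
    show "inj_on a (u1 ` ?S1)" by (rule inj_on_inverseI[of _ b]) (rule ba)
    show "a ` u1 ` ?S1 = u2 ` ?S2"
    proof
      show "a ` u1 ` ?S1 \<subseteq> u2 ` ?S2" using S by (auto simp: a_eq)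
      show "u2 ` ?S2 \<subseteq> a ` u1 ` ?S1"
      proof
        fix r assume "r \<in> u2 ` ?S2"
        then obtain p where p: "p \<in> ?S2" "r = u2 p" by blast
        \<comment> \<open>The preimage is found by splitting \<open>u2 f u1 g u2 d = u2\<close>
          after the first three factors: \<open>u2 f\<close> acts as \<open>a\<close> and
          \<open>u1\<close> lands in the required image.\<close>
        let ?s = "g (u2 (d p))"
        have s: "?s \<in> ?S1" using S pattern_hom_in_S_X[OF d(1) p(1)] by simp
        then have "a (u1 ?s) = r" using S(3) d2[OF p(1)] p(2) by (simp add: a_eq)
        then show "r \<in> a ` u1 ` ?S1" using s by blast
      qed
    qed
  qed
  moreover have "pattern_rel C1 m \<phi>s q ps \<longleftrightarrow> pattern_rel C2 m \<phi>s q (map a ps)"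
    if asm: "set \<phi>s \<subseteq> formulas L (UNIV <+> {..<m})" "q \<in> types0 L C1 m \<union> types0 L C2 m"
      "length ps = length \<phi>s" "set ps \<subseteq> u1 ` ?S1" for m \<phi>s q ps
  proof
    have q: "q \<subseteq> formulas L {..<m}" using asm(2) by (auto dest: types0_formulas)
    have ps: "set ps \<subseteq> ?S1" using asm(4) S(3) by auto
    show "pattern_rel C2 m \<phi>s q (map a ps)" if "pattern_rel C1 m \<phi>s q ps"
      using pattern_hom_pattern_rel[OF a asm(1) q asm(3) ps that] .
    assume "pattern_rel C2 m \<phi>s q (map a ps)"
    \<comment> \<open>Reflection of a relation by \<open>a\<close> is its preservation by
      \<open>b\<close>, since \<open>b\<close> undoes \<open>a\<close> on the image of
      \<open>u1\<close>.\<close>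
    then have "pattern_rel C1 m \<phi>s q (map b (map a ps))"
      using asm(3) ps pattern_hom_in_S_X[OF a]
      by (intro pattern_hom_pattern_rel[OF b asm(1) q]) auto
    moreover have "map b (map a ps) = ps"
      unfolding map_map using asm(4) by (intro map_idI) (auto intro!: ba)
    ultimately show "pattern_rel C1 m \<phi>s q ps" by simp
  qed
  ultimately show ?thesis unfolding pattern_iso_def by blast
qed

end
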